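(* Let $d,k,n\ge 1$ be integers with $d\le kn$. The distribution of a Wishart-random POVM of parameters $(d,k;n,n,\ldots,n)$ (with $n$ repeated $k$ times) is equal to the distribution of a Haar-random POVM of parameters $(d,k;n)$.
   Context: A POVM with $k$ outcomes on $\mathbb C^d$ is a $k$-tuple $(M_1,\dots,M_k)$ of positive semidefinite $d\times d$ complex matrices with $\sum_i M_i=I_d$. Haar-random POVM of parameters $(d,k;n)$, $d\le kn$: let $\{e_i\}_{i=1}^k$ be a fixed orthonormal basis of $\mathbb C^k$ and $V:\mathbb C^d\to\mathbb C^k\otimes\mathbb C^n$ a Haar-distributed random isometry (its law is the unique probability measure on isometries invariant under $V\mapsto U_2VU_1$ for all unitaries $U_1\in\mathcal U(d)$, $U_2\in\mathcal U(kn)$; equivalently $V$ consists of the first $d$ columns of a Haar unitary in $\mathcal U(kn)$). Put $M_i=V^*(|e_i\rangle\langle e_i|\otimes I_n)V\in\mathcal M_d(\mathbb C)$ for $1\le i\le k$. Wishart matrix of parameters $(d,s)$, $s$ a positive integer: $W=G^*G$ where $G\in\mathcal M_{s\times d}(\mathbb C)$ has i.i.d. standard complex Gaussian entries. Wishart-random POVM of parameters $(d,k;s_1,\dots,s_k)$: $M_i=S^{-1/2}W_iS^{-1/2}$, where $W_1,\dots,W_k$ are independent Wishart matrices of respective parameters $(d,s_i)$ and $S=\sum_{i=1}^kW_i$ (which is almost surely invertible when $\sum_i s_i\ge d$). *)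

theory Defs
  imports "HOL-Probability.Probability"
begin

text \<open>
  A complex matrix with \<open>m\<close> rows and \<open>d\<close> columns is an element of \<open>complex^'d^'m\<close> (rows outermost),
  the dimensions being the cardinalities of the index types.  The tensor product of the spaces
  \<open>complex^'k\<close> and \<open>complex^'n\<close> is \<open>complex^('k \<times> 'n)\<close>, and a \<open>k\<close>-tuple of \<open>d\<close> by \<open>d\<close> matrices is an
  element of \<open>complex^'d^'d^'k\<close>.  All these are Euclidean spaces carrying their Borel sigma-algebra,
  and the distribution of a random tuple of matrices is a measure on it.
\<close>

section \<open>Complex matrices\<close>

definition cinner :: "complex^'d \<Rightarrow> complex^'d \<Rightarrow> complex" where
  "cinner x y = (\<Sum>i\<in>UNIV. cnj (x $ i) * y $ i)"

definition ctranspose :: "complex^'d^'m \<Rightarrow> complex^'m^'d" where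
  "ctranspose A = (\<chi> i j. cnj (A $ j $ i))"

definition isometry_matrix :: "complex^'d^'m \<Rightarrow> bool" where
  "isometry_matrix V \<longleftrightarrow> ctranspose V ** V = mat 1"

definition unitary_matrix :: "complex^'d^'d \<Rightarrow> bool" where
  "unitary_matrix U \<longleftrightarrow> ctranspose U ** U = mat 1 \<and> U ** ctranspose U = mat 1"

definition positive_semidefinite :: "complex^'d^'d \<Rightarrow> bool" where
  "positive_semidefinite A \<longleftrightarrow> ctranspose A = A \<and> (\<forall>x. 0 \<le> Re (cinner x (A *v x)))"

definition psd_sqrt :: "complex^'d^'d \<Rightarrow> complex^'d^'d" where
  "psd_sqrt A = (THE R. positive_semidefinite R \<and> R ** R = A)"

text \<open>
  This is meaningful for positive definite \<open>A\<close>.  \<open>psd_sqrt\<close> takes a fixed unspecified value on matrices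
  that are not positive semidefinite, and so does \<open>matrix_inv\<close> on non-invertible ones; hence
  \<open>inv_sqrt\<close> is Borel measurable on the space of all matrices, as \<open>distr\<close> requires below.
\<close>
definition inv_sqrt :: "complex^'d^'d \<Rightarrow> complex^'d^'d" where
  "inv_sqrt A = matrix_inv (psd_sqrt A)"

definition orthonormal_basis :: "('k \<Rightarrow> complex^'k) \<Rightarrow> bool" where
  "orthonormal_basis e \<longleftrightarrow> (\<forall>i j. cinner (e i) (e j) = (if i = j then 1 else 0))"

text \<open>The operator \<open>|x\<rangle>\<langle>x|\<close>.\<close>
definition ketbra :: "complex^'k \<Rightarrow> complex^'k^'k" where
  "ketbra x = (\<chi> a b. x $ a * cnj (x $ b))"

definition tensor_matrix :: "complex^'k^'k \<Rightarrow> complex^'n^'n \<Rightarrow> complex^('k \<times> 'n)^('k \<times> 'n)" where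
  "tensor_matrix A B = (\<chi> p q. A $ fst p $ fst q * B $ snd p $ snd q)"

section \<open>Haar-random POVMs\<close>

definition is_haar_isometry_law :: "(complex^'d^'m) measure \<Rightarrow> bool" where
  "is_haar_isometry_law \<mu> \<longleftrightarrow>
     prob_space \<mu> \<and> sets \<mu> = sets borel \<and> (AE V in \<mu>. isometry_matrix V) \<and>
     (\<forall>U1 U2. unitary_matrix U1 \<longrightarrow> unitary_matrix U2 \<longrightarrow>
        distr \<mu> borel (\<lambda>V. U2 ** V ** U1) = \<mu>)"

text \<open>Such a law exists, and is then unique, if and only if \<open>CARD('d) \<le> CARD('m)\<close>.\<close>
definition haar_isometry_law :: "(complex^'d^'m) measure" where
  "haar_isometry_law = (THE \<mu>. is_haar_isometry_law \<mu>)"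

definition haar_povm_law ::
    "('k \<Rightarrow> complex^'k) \<Rightarrow> ('n::finite) itself \<Rightarrow> (complex^'d^'d^'k) measure" where
  "haar_povm_law e _ =
     distr (haar_isometry_law :: (complex^'d^('k \<times> 'n)) measure) borel
       (\<lambda>V. \<chi> i. ctranspose V ** tensor_matrix (ketbra (e i)) (mat 1 :: complex^'n^'n) ** V)"

section \<open>Wishart-random POVMs\<close>

text \<open>Normalised so that the expectation of \<open>|z|\<^sup>2\<close> is \<open>1\<close>; \<open>lborel\<close> is the area measure.\<close>
definition std_complex_gaussian :: "complex measure" where
  "std_complex_gaussian = density lborel (\<lambda>z. ennreal (exp (- (cmod z)\<^sup>2) / pi))"

text \<open>
  The number \<open>s\<close> of rows of the Gaussian matrix \<open>G\<close> is a natural number rather than a type, since it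
  may vary within a Wishart-random POVM.  The entry of \<open>G\<close> in row \<open>r\<close> and column \<open>a\<close> is \<open>G (r, a)\<close>,
  and the matrix below is the product of the conjugate transpose of \<open>G\<close> with \<open>G\<close>.
\<close>
definition wishart_law :: "nat \<Rightarrow> (complex^'d^'d) measure" where
  "wishart_law s =
     distr (PiM ({..<s} \<times> (UNIV :: 'd set)) (\<lambda>_. std_complex_gaussian)) borel
       (\<lambda>G. \<chi> a b. \<Sum>r<s. cnj (G (r, a)) * G (r, b))"

definition normalise_tuple :: "('k \<Rightarrow> complex^'d^'d) \<Rightarrow> complex^'d^'d^'k" where
  "normalise_tuple W =
     (let T = inv_sqrt (\<Sum>i\<in>UNIV. W i) in \<chi> i. T ** W i ** T)"

definition wishart_povm_law :: "('k \<Rightarrow> nat) \<Rightarrow> (complex^'d^'d^'k) measure" where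
  "wishart_povm_law s =
     distr (PiM UNIV (\<lambda>i. wishart_law (s i))) borel normalise_tuple"

end

theory Submission
  imports Defs
begin

text \<open>
  Let \<open>G\<close> be a Gaussian matrix with \<open>k n\<close> rows and \<open>d\<close> columns, and \<open>V = G (G\<^sup>* G)\<^sup>-\<^sup>1\<^sup>/\<^sup>2\<close> its isometric
  polar factor.  The law of \<open>G\<close> is invariant under unitaries on both sides, hence so is that of \<open>V\<close>, which is
  therefore the Haar law.  The Gram matrices of the \<open>k\<close> blocks of \<open>n\<close> rows of \<open>G\<close> are independent Wishart
  matrices with sum \<open>G\<^sup>* G\<close>, so normalising them amounts to replacing \<open>G\<close> by \<open>V\<close> in the block Gram
  matrices.  A general orthonormal basis differs from the standard one by a unitary, which the Haar law absorbs.

  Square roots and polar decompositions come from maximising \<open>Re (trace (U ** K))\<close> over the unitaries \<open>U\<close>, so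
  that no spectral theorem is needed.
\<close>

text \<open>The Haar law is given by a definite description, so an invariant law must be shown to
  exist and to be unique. Existence is the polar factor of a Gaussian matrix. Uniqueness compares an
  arbitrary invariant law with a Haar law on the square unitaries, and the same Gaussian
  construction, with as many columns as rows, supplies that law too. The polar factor is controlled
  only where \<open>ctranspose G ** G\<close> is invertible. The exceptional set is null, so
  identities valid off it suffice for equality of laws, but a pushforward is meaningful only for a
  map that is Borel on the whole space. Hence \<open>inv_sqrt\<close> must be shown measurable
  everywhere, including where \<open>psd_sqrt\<close> and \<open>matrix_inv\<close> take unspecified
  values.\<close>

lemma matrix_mult_nth: "(A ** B) $ i $ j = (\<Sum>k\<in>UNIV. A $ i $ k * B $ k $ j)"
  by (simp add: matrix_matrix_mult_def)

lemma matrix_vector_mult_nth: "(A *v x) $ i = (\<Sum>j\<in>UNIV. A $ i $ j * x $ j)"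
  by (simp add: matrix_vector_mult_def)

lemma matrix_add_rdistrib: "(A + B) ** C = A ** C + B ** C"
  by (simp add: vec_eq_iff matrix_mult_nth distrib_right sum.distrib)

lemma matrix_diff_ldistrib: "A ** (B - C) = A ** B - A ** (C :: 'a::ring_1^'n^'m)"
  by (simp add: vec_eq_iff matrix_mult_nth right_diff_distrib sum_subtractf)

lemma matrix_diff_rdistrib: "(A - B) ** C = A ** C - B ** (C :: 'a::ring_1^'n^'m)"
  by (simp add: vec_eq_iff matrix_mult_nth left_diff_distrib sum_subtractf)

section \<open>Adjoints and the Hermitian form\<close>

lemma ctranspose_nth [simp]: "ctranspose A $ i $ j = cnj (A $ j $ i)"
  by (simp add: ctranspose_def)

lemma ctranspose_ctranspose [simp]: "ctranspose (ctranspose A) = A"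
  by (simp add: vec_eq_iff)

lemma ctranspose_mult: "ctranspose (A ** B) = ctranspose B ** ctranspose A"
  by (simp add: vec_eq_iff matrix_mult_nth mult.commute)

lemma ctranspose_add: "ctranspose (A + B) = ctranspose A + ctranspose B"
  by (simp add: vec_eq_iff)

lemma ctranspose_diff: "ctranspose (A - B) = ctranspose A - ctranspose B"
  by (simp add: vec_eq_iff)

lemma ctranspose_mat_1 [simp]: "ctranspose (mat 1) = mat 1"
  by (simp add: vec_eq_iff mat_def)

lemma cinner_adjoint: "cinner x (A *v y) = cinner (ctranspose A *v x) y"
proof -
  have "cinner x (A *v y) = (\<Sum>i\<in>UNIV. \<Sum>j\<in>UNIV. cnj (x $ i) * (A $ i $ j * y $ j))"
    by (simp add: cinner_def matrix_vector_mult_nth sum_distrib_left)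
  also have "\<dots> = (\<Sum>j\<in>UNIV. \<Sum>i\<in>UNIV. cnj (x $ i) * (A $ i $ j * y $ j))"
    by (rule sum.swap)
  also have "\<dots> = cinner (ctranspose A *v x) y"
    by (simp add: cinner_def matrix_vector_mult_nth sum_distrib_left mult_ac)
  finally show ?thesis .
qed

lemma cinner_add_left: "cinner (x + y) z = cinner x z + cinner y z"
  by (simp add: cinner_def distrib_right sum.distrib)

lemma cinner_add_right: "cinner x (y + z) = cinner x y + cinner x z"
  by (simp add: cinner_def distrib_left sum.distrib)

lemma cinner_diff_left: "cinner (x - y) z = cinner x z - cinner y z"
  by (simp add: cinner_def left_diff_distrib sum_subtractf)

lemma cinner_diff_right: "cinner x (y - z) = cinner x y - cinner x z"
  by (simp add: cinner_def right_diff_distrib sum_subtractf)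

lemma cinner_scale_left: "cinner (c *s x) y = cnj c * cinner x y"
  by (simp add: cinner_def sum_distrib_left mult_ac)

lemma cinner_scale_right: "cinner x (c *s y) = c * cinner x y"
  by (simp add: cinner_def sum_distrib_left mult_ac)

lemma matrix_vector_mult_scale: "A *v (c *s x) = c *s (A *v (x :: 'a::comm_semiring_1^'n))"
  by (simp add: vec_eq_iff matrix_vector_mult_nth sum_distrib_left mult_ac)

lemma cinner_self: "cinner x x = complex_of_real ((norm x)\<^sup>2)"
proof -
  have "cinner x x = (\<Sum>i\<in>UNIV. complex_of_real ((norm (x $ i))\<^sup>2))"
    unfolding cinner_def by (intro sum.cong refl) (simp only: complex_norm_square mult.commute)
  also have "\<dots> = complex_of_real ((norm x)\<^sup>2)"
    by (simp add: norm_vec_def L2_set_def sum_nonneg)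
  finally show ?thesis .
qed

lemma cinner_axis_left: "cinner (axis i 1) x = x $ i"
proof -
  have "cnj (axis i 1 $ j) * x $ j = (if j = i then x $ j else 0)" for j
    by (simp add: axis_def)
  then show ?thesis by (simp add: cinner_def)
qed

lemma matrix_vector_mult_axis: "(A *v axis j 1) $ i = (A :: 'a::semiring_1^'n^'m) $ i $ j"
proof -
  have "A $ i $ k * axis j 1 $ k = (if k = j then A $ i $ k else 0)" for k
    by (simp add: axis_def)
  then show ?thesis by (simp add: matrix_vector_mult_nth)
qed

lemma trace_gram: "trace (ctranspose A ** A) = complex_of_real ((norm A)\<^sup>2)"
proof -
  have "trace (ctranspose A ** A) = (\<Sum>j\<in>UNIV. \<Sum>i\<in>UNIV. cnj (A $ i $ j) * A $ i $ j)"
    by (simp add: trace_def matrix_mult_nth)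
  also have "\<dots> = (\<Sum>i\<in>UNIV. \<Sum>j\<in>UNIV. cnj (A $ i $ j) * A $ i $ j)"
    by (rule sum.swap)
  also have "\<dots> = (\<Sum>i\<in>UNIV. cinner (A $ i) (A $ i))"
    by (simp add: cinner_def)
  also have "\<dots> = complex_of_real (\<Sum>i\<in>UNIV. (norm (A $ i))\<^sup>2)"
    by (simp add: cinner_self)
  also have "\<dots> = complex_of_real ((norm A)\<^sup>2)"
    by (simp add: norm_vec_def[of A] L2_set_def sum_nonneg)
  finally show ?thesis .
qed

lemma gram_eq_0_imp: "ctranspose A ** A = 0 \<Longrightarrow> A = 0"
  using trace_gram[of A] by (simp add: trace_def)

text \<open>Polarisation: reality of the form at \<open>x + y\<close> and at
  \<open>x + \<i> y\<close> fixes the imaginary and the real part of the cross terms, so these are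
  conjugate to each other. On axis vectors they are matrix entries.\<close>

lemma hermitianI:
  assumes "\<And>x. Im (cinner x (A *v x)) = 0"
  shows "ctranspose A = A"
proof -
  define q where "q x y = cinner x (A *v y)" for x y
  have exp: "q (x + c *s y) (x + c *s y) = q x x + c * q x y + cnj c * q y x + cnj c * c * q y y" for x y c
    by (simp add: q_def matrix_vector_right_distrib matrix_vector_mult_scale cinner_add_left
        cinner_add_right cinner_scale_left cinner_scale_right algebra_simps)
  have real: "Im (q x x) = 0" for x
    using assms by (simp add: q_def)
  have "cnj (q y x) = q x y" for x y
    using real[of "x + 1 *s y"] real[of "x + \<i> *s y"] real[of x] real[of y]
    unfolding exp by (simp add: complex_eq_iff)
  from this[of "axis _ 1" "axis _ 1"] show ?thesis
    by (simp add: q_def vec_eq_iff cinner_axis_left matrix_vector_mult_axis)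
qed

section \<open>Positive semidefinite matrices and their square roots\<close>

lemma psd_adjoint: "positive_semidefinite A \<Longrightarrow> ctranspose A = A"
  by (simp add: positive_semidefinite_def)

lemma psd_gram: "positive_semidefinite (ctranspose G ** G)"
proof -
  have "Re (cinner x ((ctranspose G ** G) *v x)) = (norm (G *v x))\<^sup>2" for x
    by (simp add: matrix_vector_mul_assoc[symmetric] cinner_adjoint cinner_self del: transpose_matrix_vector)
  then show ?thesis
    by (simp add: positive_semidefinite_def ctranspose_mult)
qed

lemma psd_congruence:
  assumes "positive_semidefinite R"
  shows "positive_semidefinite (ctranspose B ** R ** B)"
proof -
  have "cinner x ((ctranspose B ** R ** B) *v x) = cinner (B *v x) (R *v (B *v x))" for x
    by (simp add: matrix_vector_mul_assoc[symmetric] cinner_adjoint[of x "ctranspose B"])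
  then show ?thesis
    using assms by (simp add: positive_semidefinite_def ctranspose_mult matrix_mul_assoc)
qed

text \<open>A zero of a nonnegative form is a minimum. Moving from \<open>y\<close> by
  \<open>- t z\<close> with \<open>z = R *v y\<close> changes the form by \<open>- 2 t |z|^2\<close>
  to first order, which would be negative for small \<open>t > 0\<close> unless
  \<open>z = 0\<close>.\<close>

lemma psd_form_eq_0_imp:
  assumes "positive_semidefinite R" and "Re (cinner y (R *v y)) = 0"
  shows "R *v y = 0"
proof -
  define z where "z = R *v y"
  have yRz: "cinner y (R *v z) = complex_of_real ((norm z)\<^sup>2)"
    using assms(1) by (simp add: z_def cinner_adjoint[of y] psd_adjoint cinner_self)
  have zRy: "cinner z (R *v y) = complex_of_real ((norm z)\<^sup>2)"
    by (simp add: z_def[symmetric] cinner_self)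
  define C where "C = Re (cinner z (R *v z))"
  have ineq: "0 \<le> t\<^sup>2 * C - 2 * t * (norm z)\<^sup>2" for t :: real
  proof -
    define w where "w = y - complex_of_real t *s z"
    have "0 \<le> Re (cinner w (R *v w))"
      using assms(1) by (simp add: positive_semidefinite_def)
    also have "\<dots> = t\<^sup>2 * C - 2 * t * (norm z)\<^sup>2"
      using assms(2) yRz zRy unfolding w_def C_def
      by (simp add: matrix_vector_mult_diff_distrib matrix_vector_mult_scale cinner_diff_left
        cinner_diff_right cinner_scale_left cinner_scale_right algebra_simps power2_eq_square)
    finally show ?thesis .
  qed
  have "(norm z)\<^sup>2 = 0"
  proof (rule ccontr)
    assume "(norm z)\<^sup>2 \<noteq> 0"
    then have n: "(norm z)\<^sup>2 > 0" by simp
    \<comment> \<open>Small enough that \<open>t * C\<close> is at most \<open>(norm z)^2\<close>,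
      hence below \<open>2 * (norm z)^2\<close>; the \<open>+ 1\<close> keeps the denominator
      positive when \<open>C = 0\<close>.\<close>
    define t where "t = (norm z)\<^sup>2 / (\<bar>C\<bar> + 1)"
    have t: "t > 0" using n by (simp add: t_def)
    have tC: "t * (\<bar>C\<bar> + 1) = (norm z)\<^sup>2" by (simp add: t_def)
    have "t * C \<le> t * (\<bar>C\<bar> + 1)" using t by (intro mult_left_mono) auto
    then have "t * C < 2 * (norm z)\<^sup>2" using tC n by linarith
    then have "t * (t * C) < t * (2 * (norm z)\<^sup>2)" using t by simp
    then show False using ineq[of t] by (simp add: power2_eq_square mult_ac)
  qed
  then show ?thesis by (simp add: z_def)
qed

text \<open>With \<open>D = R - S\<close> we have \<open>R D + D S = R\<^sup>2 - S\<^sup>2 = 0\<close>.  Multiplying by \<open>D\<close> and taking traces, the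
  positive semidefinite matrices \<open>D R D\<close> and \<open>D S D\<close> have traces summing to \<open>0\<close>, which forces \<open>R D = S D = 0\<close>.\<close>
lemma psd_square_inj:
  assumes R: "positive_semidefinite R" and S: "positive_semidefinite S"
    and eq: "R ** R = S ** S"
  shows "R = S"
proof -
  define D where "D = R - S"
  have Dadj: "ctranspose D = D"
    using R S by (simp add: D_def ctranspose_diff psd_adjoint)
  have 1: "R ** D + D ** S = 0"
    using eq by (simp add: D_def matrix_diff_ldistrib matrix_diff_rdistrib)
  \<comment> \<open>The trace of \<open>D M D\<close>, written as a sum of values of the form of
    \<open>M\<close>, so that a vanishing trace makes each nonnegative summand vanish.\<close>
  define f where "f M = (\<Sum>i\<in>UNIV. Re (cinner (D *v axis i 1) (M *v (D *v axis i 1))))"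
    for M :: "complex^'a^'a"
  have f: "Re (trace (D ** (M ** D))) = f M" for M
  proof -
    have "trace (D ** (M ** D)) = (\<Sum>i\<in>UNIV. cinner (axis i 1) ((D ** (M ** D)) *v axis i 1))"
      by (simp add: trace_def cinner_axis_left matrix_vector_mult_axis)
    also have "\<dots> = (\<Sum>i\<in>UNIV. cinner (D *v axis i 1) (M *v (D *v axis i 1)))"
      by (simp add: matrix_vector_mul_assoc[symmetric] cinner_adjoint[of _ D] Dadj)
    finally show ?thesis by (simp add: f_def)
  qed
  have nonneg: "0 \<le> Re (cinner (D *v axis i 1) (M *v (D *v axis i 1)))"
    if "positive_semidefinite M" for M i
    using that by (simp add: positive_semidefinite_def)
  have "trace (D ** (R ** D)) + trace (D ** (S ** D)) = trace (D ** (R ** D)) + trace (D ** (D ** S))"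
    using trace_mul_sym[of "D ** S" D] by (simp add: matrix_mul_assoc)
  also have "\<dots> = trace (D ** (R ** D + D ** S))"
    by (simp add: matrix_add_ldistrib trace_add)
  also have "\<dots> = 0"
    by (simp add: 1 trace_def)
  finally have "f R + f S = 0"
    by (metis f plus_complex.simps(1) zero_complex.simps(1))
  moreover have "0 \<le> f R" "0 \<le> f S"
    using nonneg[OF R] nonneg[OF S] by (auto simp: f_def intro!: sum_nonneg)
  ultimately have fz: "f R = 0" "f S = 0" by auto
  have ker: "M ** D = 0" if M: "positive_semidefinite M" and 0: "f M = 0" for M
  proof -
    have "Re (cinner (D *v axis i 1) (M *v (D *v axis i 1))) = 0" for i
      using 0 nonneg[OF M] unfolding f_def by (subst (asm) sum_nonneg_eq_0_iff) auto
    then have "M *v (D *v axis i 1) = 0" for i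
      using psd_form_eq_0_imp[OF M] by blast
    then have "((M ** D) *v axis i 1) $ j = 0" for i j
      by (simp add: matrix_vector_mul_assoc)
    then show ?thesis
      by (simp add: vec_eq_iff matrix_vector_mult_axis)
  qed
  have "ctranspose D ** D = R ** D - S ** D"
    unfolding Dadj by (simp add: D_def matrix_diff_rdistrib)
  also have "\<dots> = 0"
    using ker[OF R fz(1)] ker[OF S fz(2)] by simp
  finally have "D = 0" by (rule gram_eq_0_imp)
  then show ?thesis by (simp add: D_def)
qed

lemma psd_sqrt_square:
  assumes "positive_semidefinite R"
  shows "psd_sqrt (R ** R) = R"
  unfolding psd_sqrt_def using assms psd_square_inj[of _ R] by (intro the_equality) auto

section \<open>Unitary matrices and polar decomposition\<close>

lemma unitary_matrixI: "ctranspose U ** U = mat 1 \<Longrightarrow> unitary_matrix U"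
  by (simp add: unitary_matrix_def matrix_left_right_inverse)

lemma unitary_matrix_iff_isometry: "unitary_matrix U \<longleftrightarrow> isometry_matrix U"
  by (auto simp: isometry_matrix_def unitary_matrix_def matrix_left_right_inverse)

lemma unitary_matrix_adjoint: "unitary_matrix U \<Longrightarrow> unitary_matrix (ctranspose U)"
  by (simp add: unitary_matrix_def)

lemma isometry_matrix_mult:
  "isometry_matrix V \<Longrightarrow> isometry_matrix W \<Longrightarrow> isometry_matrix (V ** W)"
proof -
  assume V: "isometry_matrix V" and W: "isometry_matrix W"
  have "ctranspose (V ** W) ** (V ** W) = ctranspose W ** (ctranspose V ** V) ** W"
    by (simp only: ctranspose_mult matrix_mul_assoc)
  then show ?thesis using V W by (simp add: isometry_matrix_def)
qed

lemma unitary_matrix_mult: "unitary_matrix U \<Longrightarrow> unitary_matrix W \<Longrightarrow> unitary_matrix (U ** W)"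
  by (simp add: unitary_matrix_iff_isometry isometry_matrix_mult)

lemma continuous_on_matrix_mult [continuous_intros]:
  fixes f :: "'a::topological_space \<Rightarrow> 'b::real_normed_algebra_1^'n^'m" and g :: "'a \<Rightarrow> 'b^'p^'n"
  assumes "continuous_on S f" "continuous_on S g"
  shows "continuous_on S (\<lambda>x. f x ** g x)"
  unfolding matrix_matrix_mult_def by (intro continuous_intros assms)

lemma continuous_on_ctranspose [continuous_intros]:
  assumes "continuous_on S f"
  shows "continuous_on S (\<lambda>x. ctranspose (f x))"
  unfolding ctranspose_def by (intro continuous_intros assms)

lemma continuous_on_trace [continuous_intros]:
  fixes f :: "'a::topological_space \<Rightarrow> 'b::real_normed_algebra_1^'n^'n"
  assumes "continuous_on S f"
  shows "continuous_on S (\<lambda>x. trace (f x))"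
  unfolding trace_def by (intro continuous_intros assms)

lemma closed_isometries: "closed {V. isometry_matrix V}"
  unfolding isometry_matrix_def by (intro closed_Collect_eq continuous_intros)

text \<open>The norm is the Frobenius norm, and the trace of
  \<open>ctranspose U ** U = mat 1\<close> is the dimension, so all unitaries lie on one
  sphere.\<close>

lemma compact_unitaries: "compact {U :: complex^'d^'d. unitary_matrix U}"
proof -
  have "norm U \<le> sqrt (real CARD('d))" if "unitary_matrix U" for U :: "complex^'d^'d"
  proof -
    have "complex_of_real ((norm U)\<^sup>2) = complex_of_real (real CARD('d))"
      using trace_gram[of U] that by (simp add: unitary_matrix_def trace_I)
    then have "(norm U)\<^sup>2 = real CARD('d)" by (simp only: of_real_eq_iff)
    then show ?thesis by (metis norm_ge_zero order_refl real_sqrt_unique)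
  qed
  then have "bounded {U :: complex^'d^'d. unitary_matrix U}"
    by (auto simp: bounded_iff)
  then show ?thesis
    using closed_isometries by (simp add: compact_eq_bounded_closed unitary_matrix_iff_isometry)
qed

text \<open>The unitary \<open>U\<close> maximises \<open>Re (trace (U ** K))\<close>: comparing \<open>U\<close> with \<open>W ** U\<close>, where \<open>W\<close> multiplies a
  single vector \<open>x\<close> by a phase, shows that \<open>cinner x ((U ** K) *v x)\<close> is a nonnegative real.\<close>
lemma polar_decomposition:
  fixes K :: "complex^'d^'d"
  obtains U where "unitary_matrix U" "positive_semidefinite (U ** K)"
proof -
  have "\<exists>U\<in>{U. unitary_matrix U}. \<forall>W\<in>{U. unitary_matrix U}. Re (trace (W ** K)) \<le> Re (trace (U ** K))"
    by (intro continuous_attains_sup compact_unitaries continuous_intros)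
      (auto intro!: exI[of _ "mat 1"] simp: unitary_matrix_def)
  then obtain U where U: "unitary_matrix U"
    and max: "\<And>W. unitary_matrix W \<Longrightarrow> Re (trace (W ** K)) \<le> Re (trace (U ** K))"
    by auto
  define P where "P = U ** K"
  have form: "Im (cinner x (P *v x)) = 0 \<and> 0 \<le> Re (cinner x (P *v x))" for x
  proof (cases "x = 0 \<or> cinner x (P *v x) = 0")
    case True
    then have "cinner x (P *v x) = 0" by (auto simp: cinner_def)
    then show ?thesis by simp
  next
    case False
    \<comment> \<open>\<open>c\<close> is the phase that rotates \<open>z\<close> onto the positive
      real axis: \<open>c * z\<close> is the modulus of \<open>z\<close>.\<close>
    define z N c where "z = cinner x (P *v x)" and "N = (norm x)\<^sup>2" and "c = cnj z / complex_of_real (cmod z)"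
    have z: "z \<noteq> 0" and N: "N > 0" using False by (auto simp: z_def N_def)
    have cc: "cnj c * c = 1"
      using z complex_norm_square[of z] by (simp add: c_def power2_eq_square mult.commute)
    \<comment> \<open>Chosen so that \<open>1 + s * N = c\<close>: then the identity plus
      \<open>s\<close> times the rank-one matrix of \<open>x\<close> sends \<open>x\<close> to
      \<open>c x\<close> and fixes the orthogonal complement of \<open>x\<close>. The equation below
      is exactly the unitarity of that matrix.\<close>
    define s where "s = (c - 1) / complex_of_real N"
    have s: "s + cnj s + cnj s * s * complex_of_real N = 0"
    proof -
      have "(s + cnj s + cnj s * s * complex_of_real N) * complex_of_real N
          = (c - 1) + (cnj c - 1) + (cnj c - 1) * (c - 1)"
        using N by (simp add: s_def field_simps)
      also have "\<dots> = 0" using cc by (simp add: algebra_simps)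
      finally show ?thesis using N by simp
    qed
    define B :: "complex^'d^'d" where "B = (\<chi> i j. s * (x $ i * cnj (x $ j)))"
    have BB: "ctranspose B ** B = (\<chi> i j. cnj s * s * complex_of_real N * (x $ i * cnj (x $ j)))"
    proof -
      have "(ctranspose B ** B) $ i $ j = (\<Sum>k\<in>UNIV. (cnj s * s * (x $ i * cnj (x $ j))) * (cnj (x $ k) * x $ k))" for i j
        by (simp add: matrix_mult_nth B_def mult_ac)
      also have "\<dots> i j = (cnj s * s * (x $ i * cnj (x $ j))) * cinner x x" for i j
        by (simp add: cinner_def sum_distrib_left)
      finally show ?thesis by (simp add: vec_eq_iff cinner_self N_def mult_ac)
    qed
    define W where "W = mat 1 + B"
    have "ctranspose W ** W = mat 1 + (B + ctranspose B + ctranspose B ** B)"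
      by (simp add: W_def ctranspose_add matrix_add_ldistrib matrix_add_rdistrib)
    also have "B + ctranspose B + ctranspose B ** B = 0"
    proof -
      have "(B + ctranspose B + ctranspose B ** B) $ i $ j
        = (s + cnj s + cnj s * s * complex_of_real N) * (x $ i * cnj (x $ j))" for i j
        unfolding BB by (simp add: B_def algebra_simps)
      then show ?thesis unfolding s by (simp add: vec_eq_iff)
    qed
    finally have "unitary_matrix W" by (intro unitary_matrixI) simp
    then have "Re (trace (W ** P)) \<le> Re (trace P)"
      using max[OF unitary_matrix_mult[OF _ U]] by (simp add: P_def matrix_mul_assoc)
    moreover have "trace (W ** P) = trace P + trace (B ** P)"
      by (simp add: W_def matrix_add_rdistrib trace_add)
    moreover have "trace (B ** P) = s * z"
    proof -
      have "trace (B ** P) = (\<Sum>i\<in>UNIV. \<Sum>k\<in>UNIV. s * (x $ i * cnj (x $ k)) * P $ k $ i)"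
        by (simp add: trace_def matrix_mult_nth B_def)
      also have "\<dots> = (\<Sum>k\<in>UNIV. \<Sum>i\<in>UNIV. s * (x $ i * cnj (x $ k)) * P $ k $ i)"
        by (rule sum.swap)
      also have "\<dots> = s * z"
        by (simp add: z_def cinner_def matrix_vector_mult_nth sum_distrib_left mult_ac)
      finally show ?thesis .
    qed
    ultimately have "Re (s * z) \<le> 0" by simp
    moreover have "s * z = (complex_of_real (cmod z) - z) / complex_of_real N"
    proof -
      have "c * z = complex_of_real (cmod z)"
        using z complex_norm_square[of z] by (simp add: c_def power2_eq_square field_simps)
      then show ?thesis by (simp add: s_def field_simps)
    qed
    ultimately have "(cmod z - Re z) / N \<le> 0" by simp
    then have "cmod z \<le> Re z" using N by (simp add: divide_le_0_iff)
    then have "Re z = cmod z" using complex_Re_le_cmod[of z] by simp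
    then have "Im z = 0" "0 \<le> Re z" using cmod_power2[of z] by auto
    then show ?thesis by (simp add: z_def)
  qed
  then have "positive_semidefinite P"
    using hermitianI[of P] by (simp add: positive_semidefinite_def)
  then show ?thesis using that U by (simp add: P_def)
qed

text \<open>Take \<open>U\<close> that makes \<open>K = U V W*\<close> positive semidefinite. Then
  \<open>K^2 = K* K = W W*\<close>, and the projection \<open>Q = W W*\<close> is its own square, so
  uniqueness of square roots gives \<open>K = Q\<close>. Multiplying by \<open>W\<close> on the
  right cancels \<open>W*\<close>.\<close>

lemma unitary_transitive_on_isometries:
  fixes V W :: "complex^'d^'m"
  assumes V: "isometry_matrix V" and W: "isometry_matrix W"
  obtains U where "unitary_matrix U" "U ** V = W"
proof -
  obtain U where U: "unitary_matrix U" and psd: "positive_semidefinite (U ** (V ** ctranspose W))"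
    by (rule polar_decomposition)
  define K where "K = U ** (V ** ctranspose W)"
  define Q where "Q = W ** ctranspose W"
  have "Q ** Q = W ** (ctranspose W ** W) ** ctranspose W"
    by (simp only: Q_def matrix_mul_assoc)
  then have Q: "positive_semidefinite Q" "Q ** Q = Q"
    using W psd_gram[of "ctranspose W"] by (simp_all add: Q_def isometry_matrix_def)
  have "K ** K = ctranspose K ** K"
    using psd by (simp add: K_def[symmetric] psd_adjoint)
  also have "\<dots> = W ** (ctranspose V ** (ctranspose U ** U) ** V) ** ctranspose W"
    by (simp add: K_def ctranspose_mult matrix_mul_assoc)
  also have "\<dots> = Q ** Q"
    unfolding Q(2) using U V by (simp add: unitary_matrix_def isometry_matrix_def Q_def)
  finally have "K = Q"
    by (rule psd_square_inj[OF psd[folded K_def] Q(1)])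
  then have "K ** W = Q ** W" by simp
  moreover have "K ** W = U ** V ** (ctranspose W ** W)" "Q ** W = W ** (ctranspose W ** W)"
    by (simp_all add: K_def Q_def matrix_mul_assoc)
  ultimately have "U ** V = W"
    using W by (simp add: isometry_matrix_def)
  with U that show ?thesis by blast
qed

text \<open>One fixed isometry, sending axis vectors to distinct axis vectors whenever the target is
  large enough for the chosen \<open>f\<close> to be injective. It serves to pad matrices to square
  ones, as a direction transversal to the singular matrices, and as base point in the uniqueness of
  the Haar law.\<close>

definition coordinate_embedding :: "complex^'d^'m" where
  "coordinate_embedding = (\<chi> p a. if p = (SOME f :: 'd \<Rightarrow> 'm. inj f) a then 1 else 0)"

lemma isometry_coordinate_embedding:
  assumes "CARD('d::finite) \<le> CARD('m::finite)"
  shows "isometry_matrix (coordinate_embedding :: complex^'d^'m)"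
proof -
  define f where "f = (SOME f :: 'd \<Rightarrow> 'm. inj f)"
  have "\<exists>f :: 'd \<Rightarrow> 'm. inj f"
    using card_le_inj[of "UNIV :: 'd set" "UNIV :: 'm set"] assms by auto
  then have f: "inj f" unfolding f_def by (rule someI_ex)
  have "(\<Sum>p\<in>UNIV. cnj (if p = f a then 1 else 0) * (if p = f b then 1 else 0))
      = (\<Sum>p\<in>UNIV. if p = f a then (if f a = f b then 1 else 0) else (0::complex))" for a b
    by (intro sum.cong) auto
  also have "\<dots> a b = (if a = b then 1 else 0)" for a b
    using f by (auto simp: inj_eq)
  finally show ?thesis
    by (simp add: isometry_matrix_def vec_eq_iff matrix_mult_nth coordinate_embedding_def f_def[symmetric] mat_def)
qed

text \<open>The square root of \<open>G\<^sup>* G\<close> is read off the polar decomposition of \<open>G\<close> padded to a square matrix.\<close>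
lemma psd_sqrt_gram:
  fixes G :: "complex^'d^'m"
  assumes "CARD('d) \<le> CARD('m)"
  shows "positive_semidefinite (psd_sqrt (ctranspose G ** G))"
    and "psd_sqrt (ctranspose G ** G) ** psd_sqrt (ctranspose G ** G) = ctranspose G ** G"
proof -
  define J :: "complex^'d^'m" where "J = coordinate_embedding"
  have J: "ctranspose J ** J = mat 1"
    using isometry_coordinate_embedding[OF assms] by (simp add: J_def isometry_matrix_def)
  obtain U where U: "unitary_matrix U" and psd: "positive_semidefinite (U ** (G ** ctranspose J))"
    by (rule polar_decomposition)
  define K where "K = U ** (G ** ctranspose J)"
  \<comment> \<open>Compression of the square factor \<open>K\<close> back to the small space; the
    root is found here without reference to \<open>psd_sqrt\<close>, which is identified with it
    afterwards by uniqueness.\<close>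
  define R where "R = ctranspose J ** K ** J"
  have R: "positive_semidefinite R"
    unfolding R_def K_def by (rule psd_congruence[OF psd])
  have KJ: "K ** J = U ** G"
  proof -
    have "K ** J = U ** (G ** (ctranspose J ** J))"
      by (simp only: K_def matrix_mul_assoc)
    then show ?thesis by (simp add: J)
  qed
  have JK: "ctranspose J ** K = ctranspose (U ** G)"
    unfolding KJ[symmetric] using psd by (simp add: ctranspose_mult K_def[symmetric] psd_adjoint)
  \<comment> \<open>\<open>K\<close> ends in \<open>J*\<close>, so it absorbs the projection
    \<open>J J*\<close> that appears in the middle of \<open>R ** R\<close>.\<close>
  have KJJ: "K ** J ** ctranspose J = K"
    unfolding KJ by (simp add: K_def matrix_mul_assoc)
  have "R ** R = ctranspose J ** (K ** J ** ctranspose J) ** (K ** J)"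
    unfolding R_def by (simp only: matrix_mul_assoc)
  also have "\<dots> = ctranspose (U ** G) ** (U ** G)"
    unfolding KJJ JK unfolding KJ by simp
  also have "\<dots> = ctranspose G ** (ctranspose U ** U) ** G"
    by (simp add: ctranspose_mult matrix_mul_assoc)
  also have "\<dots> = ctranspose G ** G"
    using U by (simp add: unitary_matrix_def)
  finally have RR: "R ** R = ctranspose G ** G" .
  then have "psd_sqrt (ctranspose G ** G) = R"
    using psd_sqrt_square[OF R] by simp
  with R RR show "positive_semidefinite (psd_sqrt (ctranspose G ** G))"
    "psd_sqrt (ctranspose G ** G) ** psd_sqrt (ctranspose G ** G) = ctranspose G ** G"
    by auto
qed

section \<open>Measurability of the inverse square root\<close>

lemma borel_measurable_vec_lambda [measurable (raw)]:
  fixes f :: "'i::finite \<Rightarrow> 'a \<Rightarrow> 'b::euclidean_space"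
  assumes "\<And>i. f i \<in> borel_measurable M"
  shows "(\<lambda>x. \<chi> i. f i x) \<in> borel_measurable M"
proof (subst borel_measurable_euclidean_space, intro ballI)
  fix b :: "'b^'i" assume "b \<in> Basis"
  then obtain i u where "b = axis i u" by (auto simp: Basis_vec_def)
  then show "(\<lambda>x. (\<chi> i. f i x) \<bullet> b) \<in> borel_measurable M"
    using assms by (simp add: inner_axis)
qed

lemma borel_measurable_vec_nth [measurable (raw)]:
  fixes f :: "'a \<Rightarrow> 'b::euclidean_space^'i"
  assumes "f \<in> borel_measurable M"
  shows "(\<lambda>x. f x $ i) \<in> borel_measurable M"
  by (rule borel_measurable_continuous_on[OF _ assms, of "\<lambda>x. x $ i"]) (intro continuous_intros)

lemma borel_measurable_matrix_mult [measurable (raw)]: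
  fixes f :: "'a \<Rightarrow> complex^'n^'m" and g :: "'a \<Rightarrow> complex^'p^'n"
  assumes "f \<in> borel_measurable M" "g \<in> borel_measurable M"
  shows "(\<lambda>x. f x ** g x) \<in> borel_measurable M"
  by (rule borel_measurable_continuous_Pair[OF assms, where H = "\<lambda>A B. A ** B"])
    (intro continuous_intros)

lemma borel_measurable_ctranspose [measurable]: "ctranspose \<in> borel_measurable borel"
  by (intro borel_measurable_continuous_onI continuous_intros)

lemma continuous_on_matrix_vector_mult [continuous_intros]:
  fixes f :: "'a::topological_space \<Rightarrow> 'b::real_normed_algebra_1^'n^'m" and g :: "'a \<Rightarrow> 'b^'n"
  assumes "continuous_on S f" "continuous_on S g"
  shows "continuous_on S (\<lambda>x. f x *v g x)"
  unfolding matrix_vector_mult_def by (intro continuous_intros assms)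

lemma continuous_on_cinner [continuous_intros]:
  assumes "continuous_on S f" "continuous_on S g"
  shows "continuous_on S (\<lambda>x. cinner (f x) (g x))"
  unfolding cinner_def by (intro continuous_intros assms)

lemma closed_psd: "closed {A. positive_semidefinite A}"
  unfolding positive_semidefinite_def
  by (intro closed_Collect_conj closed_Collect_all closed_Collect_eq closed_Collect_le continuous_intros)

lemma norm_trace_le: "cmod (trace A) \<le> real CARD('d) * norm A" for A :: "complex^'d^'d"
proof -
  have "cmod (A $ i $ i) \<le> norm A" for i
    by (rule order_trans[OF Finite_Cartesian_Product.norm_nth_le Finite_Cartesian_Product.norm_nth_le])
  then have "(\<Sum>i\<in>UNIV. cmod (A $ i $ i)) \<le> of_nat CARD('d) * norm A"
    by (intro sum_bounded_above) auto
  then show ?thesis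
    unfolding trace_def using norm_sum[of "\<lambda>i. A $ i $ i" UNIV] by linarith
qed

text \<open>Squaring is proper on positive semidefinite matrices, because \<open>trace (R ** R) = (norm R)\<^sup>2\<close>.\<close>
lemma closed_image_psd_square:
  fixes C :: "(complex^'d^'d) set"
  assumes "closed C"
  shows "closed ((\<lambda>R. R ** R) ` ({R. positive_semidefinite R} \<inter> C))" (is "closed (?sq ` ?P)")
proof (unfold closed_sequential_limits, intro allI impI, elim conjE)
  fix x l assume x: "\<forall>n::nat. x n \<in> ?sq ` ?P" and lim: "x \<longlonglongrightarrow> l"
  obtain R where R: "\<And>n. R n \<in> ?P" and xR: "\<And>n. x n = R n ** R n"
  proof -
    have "\<forall>n. \<exists>R. R \<in> ?P \<and> x n = R ** R" using x by blast
    then show ?thesis using that by metis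
  qed
  obtain b where b: "\<And>n. norm (x n) \<le> b"
    using convergent_imp_bounded[OF lim] by (auto simp: bounded_iff)
  have "norm (R n) \<le> sqrt (real CARD('d) * b)" for n
  proof -
    have "complex_of_real ((norm (R n))\<^sup>2) = trace (x n)"
      using trace_gram[of "R n"] R[of n] by (simp add: xR psd_adjoint)
    then have "(norm (R n))\<^sup>2 = cmod (trace (x n))"
      by (metis norm_of_real abs_power2)
    also have "\<dots> \<le> real CARD('d) * norm (x n)" by (rule norm_trace_le)
    also have "\<dots> \<le> real CARD('d) * b" using b by (intro mult_left_mono) auto
    finally show ?thesis by (rule real_le_rsqrt)
  qed
  then have "bounded (range R)" by (auto simp: bounded_iff)
  then obtain S r where r: "strict_mono r" and S: "(R \<circ> r) \<longlonglongrightarrow> S"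
    using bounded_imp_convergent_subsequence by blast
  have "S \<in> ?P"
    by (rule closed_sequentially[OF closed_Int[OF closed_psd assms] _ S]) (use R in auto)
  moreover have "(\<lambda>n. (R \<circ> r) n ** (R \<circ> r) n) \<longlonglongrightarrow> S ** S"
    by (rule continuous_on_tendsto_compose[OF _ S, of UNIV "?sq"]) (auto intro!: continuous_intros)
  then have "(x \<circ> r) \<longlonglongrightarrow> S ** S" by (simp add: xR o_def)
  then have "l = S ** S"
    using LIMSEQ_subseq_LIMSEQ[OF lim r] LIMSEQ_unique by blast
  ultimately show "l \<in> ?sq ` ?P" by blast
qed

text \<open>On squares of positive semidefinite matrices the root inverts an injective map that
  carries closed sets to closed sets; elsewhere it is constant. So the preimage of a closed set is a
  closed set, possibly together with the open complement of all squares.\<close>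

lemma borel_measurable_psd_sqrt [measurable]:
  "(psd_sqrt :: complex^'d^'d \<Rightarrow> complex^'d^'d) \<in> borel_measurable borel"
proof -
  define sq :: "complex^'d^'d \<Rightarrow> complex^'d^'d" where "sq R = R ** R" for R
  define P :: "(complex^'d^'d) set" where "P = {R. positive_semidefinite R}"
  \<comment> \<open>Without a root the defining predicate is identically false, so the description
    denotes the same matrix for every such \<open>A\<close>.\<close>
  have outside: "psd_sqrt A = (THE R. False)" if "A \<notin> sq ` P" for A
  proof -
    have "(\<lambda>R. positive_semidefinite R \<and> R ** R = A) = (\<lambda>_. False)"
      using that by (auto simp: sq_def P_def)
    then show ?thesis by (simp only: psd_sqrt_def)
  qed
  have inside: "psd_sqrt (sq R) = R" if "R \<in> P" for R
    using that psd_sqrt_square by (simp add: sq_def P_def)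
  have inj: "inj_on sq P"
    by (rule inj_on_inverseI[where g = psd_sqrt]) (rule inside)
  have closed: "psd_sqrt -` C \<in> sets borel" if C: "closed C" for C :: "(complex^'d^'d) set"
  proof -
    have "psd_sqrt -` C = sq ` (P \<inter> C) \<union> (if (THE R. False) \<in> C then - sq ` P else {})"
    proof (intro set_eqI)
      fix A show "A \<in> psd_sqrt -` C \<longleftrightarrow> A \<in> sq ` (P \<inter> C) \<union> (if (THE R. False) \<in> C then - sq ` P else {})"
      proof (cases "A \<in> sq ` P")
        case True
        then obtain R where R: "R \<in> P" "A = sq R" by blast
        have "sq R \<in> sq ` (P \<inter> C) \<longleftrightarrow> R \<in> C"
          using inj_on_image_mem_iff[OF inj R(1)] R(1) by blast
        then show ?thesis using R inside by auto
      next
        case False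
        then show ?thesis by (auto simp: outside)
      qed
    qed
    moreover have "closed (sq ` (P \<inter> C))" "closed (sq ` P)"
      using closed_image_psd_square[OF C] closed_image_psd_square[OF closed_UNIV]
      by (simp_all add: sq_def P_def)
    ultimately show ?thesis by auto
  qed
  show ?thesis
  proof (rule borel_measurableI)
    fix U :: "(complex^'d^'d) set" assume "open U"
    then have "- (psd_sqrt -` (- U)) \<in> sets borel"
      by (intro borel_comp closed) (simp add: open_closed)
    then show "psd_sqrt -` U \<inter> space borel \<in> sets borel" by (simp add: vimage_Compl)
  qed
qed

section \<open>Matrix inversion and its Borel measurability\<close>

lemma matrix_inv_works:
  assumes "invertible A"
  shows "A ** matrix_inv A = mat 1" "matrix_inv A ** A = mat 1"
  using someI_ex[OF assms[unfolded invertible_def]] by (auto simp: matrix_inv_def)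

lemma matrix_inv_unique:
  fixes A B :: "'a::field^'n^'n"
  assumes "A ** B = mat 1"
  shows "matrix_inv A = B"
proof -
  have "invertible A" using assms matrix_left_right_inverse by (auto simp: invertible_def)
  then have "matrix_inv A ** (A ** B) = B" by (simp add: matrix_mul_assoc matrix_inv_works)
  then show ?thesis by (simp add: assms)
qed

lemma continuous_on_det [continuous_intros]:
  fixes f :: "'a::topological_space \<Rightarrow> 'b::{real_normed_algebra_1,comm_ring_1}^'n^'n"
  assumes "continuous_on S f"
  shows "continuous_on S (\<lambda>x. det (f x))"
  unfolding det_def by (intro continuous_intros assms)

lemma borel_measurable_matrix_inv [measurable]:
  "(matrix_inv :: complex^'d^'d \<Rightarrow> complex^'d^'d) \<in> borel_measurable borel"
proof -
  \<comment> \<open>Cramer's rule: column \<open>l\<close> of the inverse solves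
    \<open>A x = axis l 1\<close>. Division by the determinant is included, so this is the inverse
    itself, not the adjugate. It is continuous on the open set of nonzero determinant, and off that
    set \<open>matrix_inv\<close> is constant.\<close>
  define adj :: "complex^'d^'d \<Rightarrow> complex^'d^'d"
    where "adj A = (\<chi> k l. det (\<chi> i j. if j = k then axis l 1 $ i else A $ i $ j) / det A)" for A
  have inv: "matrix_inv A = (if A \<in> {A. det A \<noteq> 0} then adj A else (SOME B. False))" for A :: "complex^'d^'d"
  proof (cases "det A = 0")
    case True
    then have "\<not> invertible A" by (simp add: invertible_det_nz)
    then have "(\<lambda>B. A ** B = mat 1 \<and> B ** A = mat 1) = (\<lambda>_. False)"
      by (auto simp: invertible_def)
    then have "matrix_inv A = (SOME B. False)"
      by (simp only: matrix_inv_def)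
    then show ?thesis using True by simp
  next
    case False
    have "A *v (matrix_inv A *v axis l 1) = axis l 1" for l
      using False by (simp add: matrix_vector_mul_assoc matrix_inv_works invertible_det_nz)
    then have "matrix_inv A *v axis l 1 = (\<chi> k. det (\<chi> i j. if j = k then axis l 1 $ i else A $ i $ j) / det A)" for l
      using cramer[OF False] by blast
    then have "(matrix_inv A *v axis l 1) $ k = adj A $ k $ l" for k l
      by (simp add: adj_def)
    then show ?thesis using False by (simp add: vec_eq_iff matrix_vector_mult_axis)
  qed
  have cont: "continuous_on {A. det A \<noteq> 0} adj"
  proof -
    have "continuous_on S (\<lambda>A. if j = k then axis l 1 $ i else A $ i $ j)"
      for S :: "(complex^'d^'d) set" and i j k l
      by (cases "j = k") (auto intro!: continuous_intros)
    then show ?thesis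
      unfolding adj_def by (intro continuous_intros) auto
  qed
  have "open {A :: complex^'d^'d. det A \<noteq> 0}"
    by (intro open_Collect_neq continuous_intros)
  then have "(\<lambda>A. if A \<in> {A. det A \<noteq> 0} then adj A else (SOME B. False)) \<in> borel_measurable borel"
    by (intro borel_measurable_continuous_on_if cont) auto
  then show ?thesis by (simp add: inv[abs_def])
qed

lemma borel_measurable_inv_sqrt [measurable]:
  "(inv_sqrt :: complex^'d^'d \<Rightarrow> complex^'d^'d) \<in> borel_measurable borel"
  unfolding inv_sqrt_def[abs_def] by measurable

lemma borel_measurable_normalise_tuple [measurable]:
  "(normalise_tuple :: ('k \<Rightarrow> complex^'d^'d) \<Rightarrow> complex^'d^'d^'k)
     \<in> borel_measurable (PiM UNIV (\<lambda>_. borel))"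
  unfolding normalise_tuple_def[abs_def] Let_def by measurable

section \<open>The isometric factor of a full-rank matrix\<close>

definition polar_factor :: "complex^'d^'m \<Rightarrow> complex^'d^'m" where
  "polar_factor G = G ** inv_sqrt (ctranspose G ** G)"

lemma borel_measurable_polar_factor [measurable]: "polar_factor \<in> borel_measurable borel"
  unfolding polar_factor_def[abs_def] by measurable

context
  fixes G :: "complex^'d^'m"
  assumes card: "CARD('d) \<le> CARD('m)"
    and inv: "invertible (ctranspose G ** G)"
begin

lemma psd_sqrt_gram_inverse:
  "psd_sqrt (ctranspose G ** G) ** inv_sqrt (ctranspose G ** G) = mat 1"
  "inv_sqrt (ctranspose G ** G) ** psd_sqrt (ctranspose G ** G) = mat 1"
proof -
  define R where "R = psd_sqrt (ctranspose G ** G)"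
  have "det R * det R = det (ctranspose G ** G)"
    using psd_sqrt_gram(2)[OF card, of G] by (simp add: R_def det_mul[symmetric])
  then have "invertible R"
    using inv by (auto simp: invertible_det_nz)
  then show "R ** inv_sqrt (ctranspose G ** G) = mat 1" "inv_sqrt (ctranspose G ** G) ** R = mat 1"
    by (simp_all add: inv_sqrt_def R_def matrix_inv_works)
qed

text \<open>The root is self-adjoint, so the adjoint of its inverse is again an inverse of
  it.\<close>

lemma inv_sqrt_gram_adjoint:
  "ctranspose (inv_sqrt (ctranspose G ** G)) = inv_sqrt (ctranspose G ** G)"
proof -
  have "psd_sqrt (ctranspose G ** G) ** ctranspose (inv_sqrt (ctranspose G ** G))
      = ctranspose (inv_sqrt (ctranspose G ** G) ** psd_sqrt (ctranspose G ** G))"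
    using psd_sqrt_gram(1)[OF card, of G] by (simp add: ctranspose_mult psd_adjoint)
  also have "\<dots> = mat 1" by (simp add: psd_sqrt_gram_inverse)
  finally show ?thesis
    unfolding inv_sqrt_def by (rule matrix_inv_unique[symmetric])
qed

lemma isometry_polar_factor: "isometry_matrix (polar_factor G)"
proof -
  define R T where "R = psd_sqrt (ctranspose G ** G)" and "T = inv_sqrt (ctranspose G ** G)"
  have "ctranspose (polar_factor G) ** polar_factor G = T ** (ctranspose G ** G) ** T"
    by (simp add: polar_factor_def ctranspose_mult inv_sqrt_gram_adjoint T_def matrix_mul_assoc)
  also have "\<dots> = T ** (R ** R) ** T"
    using psd_sqrt_gram(2)[OF card, of G] by (simp add: R_def)
  also have "\<dots> = (T ** R) ** (R ** T)"
    by (simp only: matrix_mul_assoc)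
  also have "\<dots> = mat 1"
    by (simp add: R_def T_def psd_sqrt_gram_inverse)
  finally show ?thesis by (simp add: isometry_matrix_def)
qed

text \<open>Conjugation by \<open>U\<close> turns the root of the Gram matrix of \<open>G\<close>
  into that of \<open>G ** U\<close>, by uniqueness of roots, and likewise for the inverses. In
  \<open>G U (U* T U)\<close> the middle \<open>U U*\<close> then cancels.\<close>

lemma polar_factor_mult_unitary_right:
  assumes U: "unitary_matrix U"
  shows "polar_factor (G ** U) = polar_factor G ** U"
proof -
  define R T where "R = psd_sqrt (ctranspose G ** G)" and "T = inv_sqrt (ctranspose G ** G)"
  define R' T' where "R' = ctranspose U ** R ** U" and "T' = ctranspose U ** T ** U"
  \<comment> \<open>Stated with a left factor \<open>A\<close> because
    \<open>matrix_mul_assoc\<close> brings products into left-associated form.\<close>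
  have UU: "A ** U ** ctranspose U = A" for A :: "complex^'d^'i"
    using U matrix_mul_assoc[of A U "ctranspose U"] by (simp add: unitary_matrix_def)
  have UU': "ctranspose U ** U = mat 1"
    using U by (simp add: unitary_matrix_def)
  have R': "positive_semidefinite R'"
    unfolding R'_def R_def using psd_sqrt_gram(1)[OF card] by (rule psd_congruence)
  have "R' ** R' = ctranspose U ** (R ** R) ** U"
    by (simp add: R'_def matrix_mul_assoc UU)
  also have "R ** R = ctranspose G ** G"
    using psd_sqrt_gram(2)[OF card] by (simp add: R_def)
  finally have "R' ** R' = ctranspose (G ** U) ** (G ** U)"
    by (simp add: ctranspose_mult matrix_mul_assoc)
  then have "psd_sqrt (ctranspose (G ** U) ** (G ** U)) = R'"
    using psd_sqrt_square[OF R'] by simp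
  moreover have "R' ** T' = mat 1"
  proof -
    have "R' ** T' = ctranspose U ** (R ** T) ** U"
      by (simp add: R'_def T'_def matrix_mul_assoc UU)
    then show ?thesis by (simp add: R_def T_def psd_sqrt_gram_inverse UU')
  qed
  ultimately have "inv_sqrt (ctranspose (G ** U) ** (G ** U)) = T'"
    unfolding inv_sqrt_def by (simp add: matrix_inv_unique)
  then show ?thesis
    by (simp add: polar_factor_def T'_def T_def matrix_mul_assoc UU)
qed

end

lemma polar_factor_mult_unitary_left:
  assumes "unitary_matrix U"
  shows "polar_factor (U ** G) = U ** polar_factor G"
proof -
  have "ctranspose (U ** G) ** (U ** G) = ctranspose G ** (ctranspose U ** U) ** G"
    by (simp only: ctranspose_mult matrix_mul_assoc)
  also have "\<dots> = ctranspose G ** G"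
    using assms by (simp add: unitary_matrix_def)
  finally show ?thesis
    by (simp only: polar_factor_def matrix_mul_assoc)
qed

section \<open>Gaussian matrices\<close>

text \<open>Evaluate \<open>\<integral>\<integral> indicator A (x + y) * indicator B y\<close> in both orders, where \<open>B\<close> is the unit ball.\<close>
lemma lborel_unique:
  fixes \<nu> :: "'a::euclidean_space measure"
  assumes sets: "sets \<nu> = sets borel" and "sigma_finite_measure \<nu>"
    and inv: "\<And>c. distr \<nu> borel ((+) c) = \<nu>"
    and ball: "emeasure \<nu> (ball 0 1) = emeasure lborel (ball (0::'a) 1)"
  shows "\<nu> = lborel"
proof (rule measure_eqI)
  show "sets \<nu> = sets lborel" using sets by simp
  fix A assume "A \<in> sets \<nu>"
  then have A[measurable]: "A \<in> sets borel" by (simp add: sets)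
  note [measurable_cong] = sets
  interpret \<nu>: sigma_finite_measure \<nu> by fact
  interpret P: pair_sigma_finite \<nu> "lborel :: 'a measure" ..
  define B where "B = ball (0::'a) 1"
  have B[measurable]: "B \<in> sets borel" by (simp add: B_def)
  have space: "space \<nu> = UNIV" using sets_eq_imp_space_eq[OF sets] by simp
  have nu_shift: "(\<integral>\<^sup>+ x. f (c + x) \<partial>\<nu>) = (\<integral>\<^sup>+ x. f x \<partial>\<nu>)"
    if [measurable]: "f \<in> borel_measurable borel" for f c
    by (subst (2) inv[of c, symmetric]) (simp add: nn_integral_distr)
  have lborel_shift: "(\<integral>\<^sup>+ x. f (c + x) \<partial>lborel) = (\<integral>\<^sup>+ x. f x \<partial>lborel)"
    if [measurable]: "f \<in> borel_measurable borel" for f and c :: 'a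
    by (subst (2) lborel_distr_plus[of c, symmetric]) (simp add: nn_integral_distr)
  have "emeasure \<nu> A * emeasure lborel B
      = (\<integral>\<^sup>+ y. (\<integral>\<^sup>+ x. indicator A (y + x) * indicator B y \<partial>\<nu>) \<partial>lborel)"
    by (simp add: nn_integral_multc nu_shift[of "indicator A"] nn_integral_cmult sets)
  also have "\<dots> = (\<integral>\<^sup>+ x. (\<integral>\<^sup>+ y. indicator A (y + x) * indicator B y \<partial>lborel) \<partial>\<nu>)"
    by (rule P.Fubini') measurable
  also have "\<dots> = (\<integral>\<^sup>+ x. (\<integral>\<^sup>+ y. indicator A y * indicator B (- y + x) \<partial>lborel) \<partial>\<nu>)"
  proof (rule nn_integral_cong)
    fix x
    \<comment> \<open>Translating \<open>y\<close> by \<open>x\<close> leaves \<open>- y\<close> in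
      the ball, which is symmetric under negation.\<close>
    have "indicator B (- (x + y) + x) = (indicator B y :: ennreal)" for y
      by (simp add: B_def indicator_def)
    then show "(\<integral>\<^sup>+ y. indicator A (y + x) * indicator B y \<partial>lborel)
        = (\<integral>\<^sup>+ y. indicator A y * indicator B (- y + x) \<partial>lborel)"
      by (subst lborel_shift[of "\<lambda>y. indicator A y * indicator B (- y + x)" x, symmetric]) (simp_all add: add.commute)
  qed
  also have "\<dots> = (\<integral>\<^sup>+ y. (\<integral>\<^sup>+ x. indicator A y * indicator B (- y + x) \<partial>\<nu>) \<partial>lborel)"
    by (rule P.Fubini'[symmetric]) measurable
  also have "\<dots> = emeasure lborel A * emeasure \<nu> B"
    using nu_shift[of "indicator B" "- _"] by (simp add: nn_integral_cmult nn_integral_multc sets)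
  finally have "emeasure \<nu> A * emeasure lborel B = emeasure lborel A * emeasure lborel B"
    using ball by (simp add: B_def)
  moreover have "emeasure lborel B \<noteq> 0"
    using content_ball_pos[of 1 "0::'a"] by (auto simp: B_def measure_def)
  moreover have "emeasure lborel B \<noteq> top"
    using emeasure_lborel_ball_finite[of "0::'a" 1] by (auto simp: B_def)
  ultimately show "emeasure \<nu> A = emeasure lborel A"
    by (metis ennreal_mult_cancel_left mult.commute)
qed

text \<open>The image measure meets the characterisation of Lebesgue measure: a translation by
  \<open>c = T d\<close> after \<open>T\<close> is a translation by \<open>d\<close> before it, and
  \<open>T\<close> preserves balls around the origin.\<close>

lemma lborel_distr_orthogonal:
  fixes T :: "'a::euclidean_space \<Rightarrow> 'a"
  assumes "orthogonal_transformation T"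
  shows "distr lborel borel T = lborel"
proof (rule lborel_unique)
  have lin: "linear T" and norm: "norm (T x) = norm x" for x
    using assms by (auto simp: orthogonal_transformation)
  have [measurable]: "T \<in> borel_measurable borel"
    by (intro borel_measurable_continuous_onI linear_continuous_on linear_conv_bounded_linear[THEN iffD1] lin)
  show "sets (distr lborel borel T) = sets borel" by simp
  show "emeasure (distr lborel borel T) (ball 0 1) = emeasure lborel (ball (0::'a) 1)"
    by (subst emeasure_distr) (auto intro!: arg_cong2[where f = emeasure] simp: norm)
  show "sigma_finite_measure (distr lborel borel T)"
  proof
    have "emeasure (distr lborel borel T) (cball 0 r) \<noteq> \<infinity>" for r
    proof -
      have "emeasure (distr lborel borel T) (cball 0 r) = emeasure lborel (cball (0::'a) r)"
        by (subst emeasure_distr) (auto intro!: arg_cong2[where f = emeasure] simp: norm)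
      then show ?thesis using emeasure_lborel_cball_finite[of "0::'a" r] by auto
    qed
    then show "\<exists>A. countable A \<and> A \<subseteq> sets (distr lborel borel T) \<and> \<Union> A = space (distr lborel borel T)
        \<and> (\<forall>a\<in>A. emeasure (distr lborel borel T) a \<noteq> \<infinity>)"
      by (intro exI[of _ "range (\<lambda>n::nat. cball 0 (real n))"]) (auto intro: real_arch_simple)
  qed
  show "distr (distr lborel borel T) borel ((+) c) = distr lborel borel T" for c
  proof -
    obtain d where d: "c = T d"
      using orthogonal_transformation_surj[OF assms] by (metis surjD)
    have "(+) c \<circ> T = T \<circ> (+) d"
      by (auto simp: d linear_add[OF lin])
    then have "distr (distr lborel borel T) borel ((+) c) = distr (distr lborel borel ((+) d)) borel T"
      by (simp add: distr_distr)
    then show ?thesis by (simp only: lborel_distr_plus)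
  qed
qed

section \<open>The Gaussian law on matrices and its invariance under unitaries\<close>

text \<open>Given by a density in the norm alone, so that invariance under norm-preserving linear
  maps is visible; independence of the entries is recovered in
  \<open>gaussian_matrix_law_eq_PiM\<close>. Each complex entry contributes one factor
  \<open>pi\<close>.\<close>

definition gaussian_matrix_law :: "(complex^'d^'m) measure" where
  "gaussian_matrix_law = density lborel (\<lambda>G. ennreal (exp (- (norm G)\<^sup>2) / pi ^ CARD('m \<times> 'd)))"

lemma sets_gaussian_matrix_law [simp, measurable_cong]: "sets gaussian_matrix_law = sets borel"
  by (simp add: gaussian_matrix_law_def)

lemma space_gaussian_matrix_law [simp]: "space gaussian_matrix_law = UNIV"
  by (simp add: gaussian_matrix_law_def)

lemma gaussian_matrix_law_orthogonal:
  fixes T :: "complex^'d^'m \<Rightarrow> complex^'d^'m"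
  assumes "orthogonal_transformation T"
  shows "distr gaussian_matrix_law borel T = gaussian_matrix_law"
proof -
  have norm: "norm (T x) = norm x" for x
    using assms by (auto simp: orthogonal_transformation)
  have [measurable]: "T \<in> borel_measurable borel"
    using assms by (intro borel_measurable_continuous_onI linear_continuous_on linear_conv_bounded_linear[THEN iffD1])
      (auto simp: orthogonal_transformation)
  define g :: "complex^'d^'m \<Rightarrow> ennreal" where "g G = ennreal (exp (- (norm G)\<^sup>2) / pi ^ CARD('m \<times> 'd))" for G
  have g: "g \<in> borel_measurable borel" unfolding g_def[abs_def] by measurable
  have "density (distr lborel borel T) g = distr (density lborel (\<lambda>x. g (T x))) borel T"
    by (rule density_distr) (use g in auto)
  moreover have "gaussian_matrix_law = density lborel g" "g (T x) = g x" for x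
    by (simp_all add: gaussian_matrix_law_def g_def[abs_def] norm)
  ultimately show ?thesis
    by (simp add: lborel_distr_orthogonal[OF assms])
qed

lemma norm_isometry_mult:
  assumes "isometry_matrix U"
  shows "norm (U ** G) = norm G"
proof -
  have "ctranspose (U ** G) ** (U ** G) = ctranspose G ** (ctranspose U ** U) ** G"
    by (simp only: ctranspose_mult matrix_mul_assoc)
  then have "complex_of_real ((norm (U ** G))\<^sup>2) = complex_of_real ((norm G)\<^sup>2)"
    using assms by (simp only: isometry_matrix_def matrix_mul_rid trace_gram[symmetric])
  then show ?thesis by (simp only: of_real_eq_iff) simp
qed

lemma norm_ctranspose: "norm (ctranspose A) = norm A"
proof -
  have "complex_of_real ((norm (ctranspose A))\<^sup>2) = complex_of_real ((norm A)\<^sup>2)"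
    using trace_mul_sym[of A "ctranspose A"] trace_gram[of A] trace_gram[of "ctranspose A"] by simp
  then show ?thesis by (simp only: of_real_eq_iff) simp
qed

text \<open>Two-sided multiplication is linear over the reals and preserves the Frobenius norm;
  multiplication on the right becomes multiplication on the left after taking adjoints.\<close>

lemma gaussian_matrix_law_unitary:
  assumes U1: "unitary_matrix U1" and U2: "unitary_matrix U2"
  shows "distr gaussian_matrix_law borel (\<lambda>G. U2 ** G ** U1) = gaussian_matrix_law"
proof (rule gaussian_matrix_law_orthogonal, unfold orthogonal_transformation, intro conjI allI)
  have scale: "A ** (c *\<^sub>R B) = c *\<^sub>R (A ** B)" "(c *\<^sub>R A) ** B = c *\<^sub>R (A ** B)"
    for A :: "complex^'i^'j" and B :: "complex^'l^'i" and c
    by (simp_all add: vec_eq_iff matrix_mult_nth scaleR_sum_right)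
  show "linear (\<lambda>G. U2 ** G ** U1)"
    by (intro linearI) (simp_all add: matrix_add_ldistrib matrix_add_rdistrib scale)
  fix G
  have "norm (U2 ** G ** U1) = norm (ctranspose U1 ** ctranspose (U2 ** G))"
    by (metis norm_ctranspose ctranspose_mult)
  also have "\<dots> = norm G"
    using unitary_matrix_adjoint[OF U1] U2
    by (simp add: norm_isometry_mult norm_ctranspose unitary_matrix_iff_isometry)
  finally show "norm (U2 ** G ** U1) = norm G" .
qed

section \<open>Almost sure invertibility of the Gram matrix\<close>

text \<open>Substituting \<open>s = 1/t\<close> turns the characteristic polynomial into
  \<open>q(s) = det (1 + s K)\<close> up to a power of \<open>t\<close>. It is nonzero because
  \<open>q(0) = det 1 = 1\<close>, so no leading coefficient has to be computed;
  \<open>t = 0\<close> is added as one extra point.\<close>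

lemma finite_singular_shifts:
  fixes K :: "complex^'d^'d"
  shows "finite {t::real. det (K + t *\<^sub>R mat 1) = 0}"
proof -
  define q where "q = det (\<chi> i j. [:mat 1 $ i $ j, K $ i $ j:])"
  have q: "poly q s = det (\<chi> i j. mat 1 $ i $ j + s * K $ i $ j)" for s
    by (simp add: q_def det_def poly_sum poly_prod)
  have "poly q 0 = 1"
    using det_I[where 'a = complex and 'n = 'd] by (simp add: q)
  then have "q \<noteq> 0" by auto
  then have fin: "finite {s. poly q s = 0}" by (rule poly_roots_finite)
  have "poly q (inverse (of_real t)) = 0" if "t \<noteq> 0" "det (\<chi> i j. K $ i $ j + of_real t * mat 1 $ i $ j) = 0" for t :: real
  proof -
    have "(\<chi> i j. K $ i $ j + of_real t * mat 1 $ i $ j)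
        = (\<chi> i. of_real t *s (\<chi> j. mat 1 $ i $ j + inverse (of_real t) * K $ i $ j))"
      using that(1) by (simp add: vec_eq_iff field_simps)
    then have "0 = (\<Prod>i\<in>(UNIV :: 'd set). of_real t) * poly q (inverse (of_real t))"
      using that(2) det_rows_mul[of "\<lambda>_. of_real t" "\<lambda>i. \<chi> j. mat 1 $ i $ j + inverse (of_real t) * K $ i $ j"]
      by (simp add: q)
    then show ?thesis using that(1) by simp
  qed
  moreover have "K + t *\<^sub>R mat 1 = (\<chi> i j. K $ i $ j + of_real t * mat 1 $ i $ j)" for t :: real
    by (simp add: vec_eq_iff scaleR_conv_of_real[where 'a = complex])
  ultimately have "{t::real. det (K + t *\<^sub>R mat 1) = 0} \<subseteq> {0} \<union> (\<lambda>t. inverse (of_real t)) -` {s. poly q s = 0}"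
    by auto
  moreover have "finite ((\<lambda>t::real. inverse (of_real t)) -` {s :: complex. poly q s = 0})"
    by (intro finite_vimageI fin injI) simp
  ultimately show ?thesis by (meson finite.emptyI finite.insertI finite_UnI finite_subset)
qed

text \<open>Translating by multiples of an isometry \<open>J\<close> moves any \<open>G\<close> out of the singular set except for finitely
  many multiples, so the singular set is null by Fubini and translation invariance.\<close>
lemma AE_lborel_det_nonzero:
  fixes J :: "complex^'d^'m"
  assumes J: "isometry_matrix J"
  shows "AE G in lborel. det (ctranspose J ** G) \<noteq> 0"
proof -
  define Z where "Z = {G. det (ctranspose J ** G) = 0}"
  have "closed Z"
    unfolding Z_def by (intro closed_Collect_eq continuous_intros)
  then have Z[measurable]: "Z \<in> sets borel" by simp
  have shift: "(\<integral>\<^sup>+ G. indicator Z (c + G) \<partial>lborel) = emeasure lborel Z" for c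
  proof -
    have "(\<integral>\<^sup>+ G. indicator Z (c + G) \<partial>lborel) = (\<integral>\<^sup>+ G. indicator Z G \<partial>distr lborel borel ((+) c))"
      by (subst nn_integral_distr) auto
    then show ?thesis by (simp add: lborel_distr_plus)
  qed
  \<comment> \<open>The interval has length 1 and every translate of \<open>Z\<close> has the
    measure of \<open>Z\<close>, so averaging over \<open>t\<close> changes nothing.\<close>
  have "emeasure lborel Z = (\<integral>\<^sup>+ t. (\<integral>\<^sup>+ G. indicator {0..1::real} t * indicator Z (t *\<^sub>R J + G) \<partial>lborel) \<partial>lborel)"
    by (simp add: nn_integral_cmult shift nn_integral_multc)
  also have "\<dots> = (\<integral>\<^sup>+ G. (\<integral>\<^sup>+ t. indicator {0..1::real} t * indicator Z (t *\<^sub>R J + G) \<partial>lborel) \<partial>lborel)"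
    by (rule lborel_pair.Fubini'[symmetric]) measurable
  also have "\<dots> = (\<integral>\<^sup>+ G. 0 \<partial>(lborel :: (complex^'d^'m) measure))"
  proof (intro nn_integral_cong)
    fix G :: "complex^'d^'m"
    have "ctranspose J ** (t *\<^sub>R J + G) = ctranspose J ** G + t *\<^sub>R mat 1" for t
    proof -
      have "ctranspose J ** (t *\<^sub>R J) = t *\<^sub>R (ctranspose J ** J)"
        by (simp add: vec_eq_iff matrix_mult_nth scaleR_sum_right)
      then show ?thesis
        using J by (simp add: matrix_add_ldistrib isometry_matrix_def)
    qed
    then have "finite {t. t *\<^sub>R J + G \<in> Z}"
      using finite_singular_shifts[of "ctranspose J ** G"] by (simp add: Z_def)
    then have "AE t in lborel. t \<notin> {t. t *\<^sub>R J + G \<in> Z}"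
      by (intro AE_not_in finite_imp_null_set_lborel)
    then show "(\<integral>\<^sup>+ t. indicator {0..1::real} t * indicator Z (t *\<^sub>R J + G) \<partial>lborel) = 0"
      by (subst nn_integral_0_iff_AE) (auto elim!: eventually_mono)
  qed
  finally have "Z \<in> null_sets lborel" by (auto simp: null_sets_def)
  then show ?thesis
    by (auto dest: AE_not_in simp: Z_def)
qed

text \<open>The kernel of \<open>G* G\<close> is that of \<open>G\<close>, which is contained in the
  trivial kernel of \<open>J* G\<close>.\<close>

lemma invertible_gram:
  fixes G :: "complex^'d^'m"
  assumes "det (ctranspose J ** G) \<noteq> 0"
  shows "invertible (ctranspose G ** G)"
proof -
  have "x = 0" if "(ctranspose G ** G) *v x = 0" for x
  proof -
    have "cinner (G *v x) (G *v x) = cinner x ((ctranspose G ** G) *v x)"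
      by (simp add: cinner_adjoint[of x "ctranspose G"] matrix_vector_mul_assoc[symmetric])
    then have "G *v x = 0"
      using that by (simp add: cinner_self) (simp add: cinner_def)
    then have "(ctranspose J ** G) *v x = 0"
      by (simp add: matrix_vector_mul_assoc[symmetric])
    moreover have "\<exists>B. B ** (ctranspose J ** G) = mat 1"
      using assms by (auto simp: invertible_det_nz[symmetric] invertible_def)
    ultimately show "x = 0"
      by (simp add: matrix_left_invertible_ker)
  qed
  then show ?thesis
    by (simp add: invertible_left_inverse matrix_left_invertible_ker)
qed

lemma AE_gaussian_invertible_gram:
  assumes "CARD('d) \<le> CARD('m)"
  shows "AE G :: complex^'d^'m in gaussian_matrix_law. invertible (ctranspose G ** G)"
proof -
  have "AE G :: complex^'d^'m in lborel. invertible (ctranspose G ** G)"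
    using AE_lborel_det_nonzero[OF isometry_coordinate_embedding[OF assms]]
    by (rule AE_mp) (auto intro: invertible_gram)
  then show ?thesis
    unfolding gaussian_matrix_law_def by (subst AE_density) (auto elim!: eventually_mono)
qed

section \<open>Independent Gaussian entries\<close>

lemma sets_std_complex_gaussian [simp, measurable_cong]: "sets std_complex_gaussian = sets borel"
  by (simp add: std_complex_gaussian_def)

lemma space_std_complex_gaussian [simp]: "space std_complex_gaussian = UNIV"
  by (simp add: std_complex_gaussian_def)

text \<open>Real and imaginary part are independent centred normal variables of variance
  \<open>1/2\<close>, whence the standard deviation \<open>1 / sqrt 2\<close>.\<close>

lemma prob_space_std_complex_gaussian: "prob_space std_complex_gaussian"
proof
  have 1: "(\<integral>\<^sup>+ x. ennreal (normal_density 0 (1 / sqrt 2) x) \<partial>lborel) = 1"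
    using prob_space.emeasure_space_1[OF prob_space_normal_density[of "1 / sqrt 2" 0]]
    by (simp add: emeasure_density)
  have "exp (- (cmod z)\<^sup>2) / pi = (\<Prod>b\<in>Basis. normal_density 0 (1 / sqrt 2) (z \<bullet> b))" for z
    by (simp add: Basis_complex_def normal_density_def power_divide cmod_power2 exp_add[symmetric]
        inner_complex_def)
  then have "emeasure std_complex_gaussian (space std_complex_gaussian)
      = (\<integral>\<^sup>+ z. (\<Prod>b\<in>Basis. ennreal (normal_density 0 (1 / sqrt 2) (z \<bullet> b))) \<partial>(lborel :: complex measure))"
    by (simp add: std_complex_gaussian_def emeasure_density prod_ennreal)
  also have "\<dots> = 1"
    by (subst nn_integral_lborel_prod) (simp_all add: 1)
  finally show "emeasure std_complex_gaussian (space std_complex_gaussian) = 1" .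
qed

text \<open>Lebesgue measure is determined by boxes. The basis of the matrix space is indexed by an
  entry together with a basis element of the complex plane, so a box is a product of planar boxes
  and its volume factorises.\<close>

lemma lborel_matrix_eq_PiM:
  "distr (PiM (UNIV :: ('m \<times> 'd) set) (\<lambda>_. lborel)) borel (\<lambda>x. \<chi> p a. x (p, a))
     = (lborel :: (complex^'d^'m) measure)" (is "distr ?P _ ?f = _")
proof (rule lborel_eqI[symmetric])
  interpret product_sigma_finite "\<lambda>_ :: 'm \<times> 'd. lborel :: complex measure" ..
  have f[measurable]: "?f \<in> borel_measurable ?P"
    by measurable
  show "sets (distr ?P borel ?f) = sets borel" by simp
  fix l u :: "complex^'d^'m" assume lu: "\<And>b. b \<in> Basis \<Longrightarrow> l \<bullet> b \<le> u \<bullet> b"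
  have Basis: "(Basis :: (complex^'d^'m) set) = (\<lambda>((p, a), b). axis p (axis a b)) ` (UNIV \<times> Basis)"
    by (auto simp: Basis_vec_def image_iff) blast
  have inj: "inj_on (\<lambda>((p, a), b). axis p (axis a b)) (UNIV \<times> (Basis :: complex set))"
    by (auto intro!: inj_onI simp: axis_eq_axis axis_eq_0_iff)
  have box: "?f -` box l u \<inter> space ?P = (\<Pi>\<^sub>E (p, a)\<in>UNIV. box (l $ p $ a) (u $ p $ a))"
    by (auto simp: mem_box Basis inner_axis space_PiM PiE_iff Pi_iff)
  have le: "l $ p $ a \<bullet> b \<le> u $ p $ a \<bullet> b" if "b \<in> Basis" for p a b
    using lu[of "axis p (axis a b)"] that by (simp add: inner_axis)
  have "emeasure (distr ?P borel ?f) (box l u) = emeasure ?P (\<Pi>\<^sub>E (p, a)\<in>UNIV. box (l $ p $ a) (u $ p $ a))"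
    by (subst emeasure_distr) (simp_all only: box f, simp)
  also have "\<dots> = (\<Prod>(p, a)\<in>UNIV. emeasure lborel (box (l $ p $ a) (u $ p $ a)))"
    by (subst emeasure_PiM) (auto intro!: prod.cong)
  also have "\<dots> = (\<Prod>(p, a)\<in>UNIV. ennreal (\<Prod>b\<in>Basis. (u $ p $ a - l $ p $ a) \<bullet> b))"
    by (intro prod.cong refl) (auto simp: le)
  also have "\<dots> = ennreal (\<Prod>(p, a)\<in>UNIV. \<Prod>b\<in>Basis. (u $ p $ a - l $ p $ a) \<bullet> b)"
    by (subst prod_ennreal[symmetric]) (auto intro!: prod.cong prod_nonneg simp: inner_diff_left le)
  also have "(\<Prod>(p, a)\<in>UNIV. \<Prod>b\<in>Basis. (u $ p $ a - l $ p $ a) \<bullet> b)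
      = (\<Prod>((p, a), b)\<in>UNIV \<times> Basis. (u $ p $ a - l $ p $ a) \<bullet> b)"
    by (subst prod.cartesian_product[symmetric]) (auto intro!: prod.cong)
  also have "\<dots> = (\<Prod>b\<in>Basis. (u - l) \<bullet> b)"
    unfolding Basis by (subst prod.reindex[OF inj]) (auto intro!: prod.cong simp: inner_axis)
  finally show "emeasure (distr ?P borel ?f) (box l u) = (\<Prod>b\<in>Basis. (u - l) \<bullet> b)" .
qed

text \<open>It suffices to compare rectangles, where the integrand is a product of functions of one
  coordinate each.\<close>

lemma density_PiM:
  fixes I :: "'i set"
  assumes I: "finite I" and M: "\<And>i. sigma_finite_measure (M i)"
    and D: "\<And>i. sigma_finite_measure (density (M i) (f i))"
    and f[measurable]: "\<And>i. f i \<in> borel_measurable (M i)"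
  shows "PiM I (\<lambda>i. density (M i) (f i)) = density (PiM I M) (\<lambda>x. \<Prod>i\<in>I. f i (x i))"
proof -
  interpret D: product_sigma_finite "\<lambda>i. density (M i) (f i)"
    using D by (simp add: product_sigma_finite_def)
  interpret M: product_sigma_finite M
    using M by (simp add: product_sigma_finite_def)
  have sets: "sets (PiM I (\<lambda>i. density (M i) (f i))) = sets (PiM I M)"
    by (intro sets_PiM_cong) auto
  show ?thesis
  proof (rule D.PiM_eqI[symmetric, OF I])
    show "sets (density (PiM I M) (\<lambda>x. \<Prod>i\<in>I. f i (x i))) = sets (PiM I (\<lambda>i. density (M i) (f i)))"
      by (simp add: sets)
    fix A assume "\<And>i. i \<in> I \<Longrightarrow> A i \<in> sets (density (M i) (f i))"
    then have A[measurable]: "i \<in> I \<Longrightarrow> A i \<in> sets (M i)" for i by simp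
    have F: "(\<lambda>x. \<Prod>i\<in>I. f i (x i)) \<in> borel_measurable (PiM I M)"
      by measurable
    have "emeasure (density (PiM I M) (\<lambda>x. \<Prod>i\<in>I. f i (x i))) (Pi\<^sub>E I A)
        = (\<integral>\<^sup>+ x. (\<Prod>i\<in>I. f i (x i)) * indicator (Pi\<^sub>E I A) x \<partial>PiM I M)"
      using I by (intro emeasure_density F) (auto intro!: sets_PiM_I_finite)
    also have "\<dots> = (\<integral>\<^sup>+ x. (\<Prod>i\<in>I. f i (x i) * indicator (A i) (x i)) \<partial>PiM I M)"
    proof (intro nn_integral_cong)
      fix x assume "x \<in> space (PiM I M)"
      then have "indicator (Pi\<^sub>E I A) x = (\<Prod>i\<in>I. indicator (A i) (x i) :: ennreal)"
        using I by (auto simp: indicator_def space_PiM PiE_iff)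
      then show "(\<Prod>i\<in>I. f i (x i)) * indicator (Pi\<^sub>E I A) x = (\<Prod>i\<in>I. f i (x i) * indicator (A i) (x i))"
        by (simp add: prod.distrib)
    qed
    also have "\<dots> = (\<Prod>i\<in>I. \<integral>\<^sup>+ x. f i x * indicator (A i) x \<partial>M i)"
      by (rule M.product_nn_integral_prod[OF I]) measurable
    also have "\<dots> = (\<Prod>i\<in>I. emeasure (density (M i) (f i)) (A i))"
      by (intro prod.cong refl) (simp add: emeasure_density)
    finally show "emeasure (density (PiM I M) (\<lambda>x. \<Prod>i\<in>I. f i (x i))) (Pi\<^sub>E I A)
        = (\<Prod>i\<in>I. emeasure (density (M i) (f i)) (A i))" .
  qed
qed

text \<open>The squared norm is the sum of the squared moduli of the entries, so the density splits
  into one factor per entry.\<close>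

lemma gaussian_matrix_law_eq_PiM:
  "distr (PiM (UNIV :: ('m \<times> 'd) set) (\<lambda>_. std_complex_gaussian)) borel (\<lambda>x. \<chi> p a. x (p, a))
     = (gaussian_matrix_law :: (complex^'d^'m) measure)"
proof -
  define h :: "complex \<Rightarrow> ennreal" where "h z = ennreal (exp (- (cmod z)\<^sup>2) / pi)" for z
  have h[measurable]: "h \<in> borel_measurable borel" unfolding h_def[abs_def] by measurable
  define H :: "complex^'d^'m \<Rightarrow> ennreal" where "H G = (\<Prod>(p, a)\<in>UNIV. h (G $ p $ a))" for G
  have [measurable]: "H \<in> borel_measurable borel" unfolding H_def[abs_def] by measurable
  have H: "H G = ennreal (exp (- (norm G)\<^sup>2) / pi ^ CARD('m \<times> 'd))" for G
  proof -
    have "(norm G)\<^sup>2 = (\<Sum>p\<in>UNIV. \<Sum>a\<in>UNIV. (cmod (G $ p $ a))\<^sup>2)"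
      by (simp add: norm_vec_def L2_set_def sum_nonneg)
    also have "\<dots> = (\<Sum>(p, a)\<in>UNIV. (cmod (G $ p $ a))\<^sup>2)"
      by (simp add: sum.cartesian_product)
    finally have "(norm G)\<^sup>2 = (\<Sum>(p, a)\<in>UNIV. (cmod (G $ p $ a))\<^sup>2)" .
    then show ?thesis
      by (simp add: H_def h_def prod_ennreal case_prod_beta prod_dividef exp_sum sum_negf[symmetric])
  qed
  have g: "std_complex_gaussian = density lborel h"
    by (simp add: std_complex_gaussian_def h_def[abs_def])
  have "PiM (UNIV :: ('m \<times> 'd) set) (\<lambda>_. std_complex_gaussian)
      = density (PiM UNIV (\<lambda>_. lborel)) (\<lambda>x. \<Prod>i\<in>UNIV. h (x i))"
    unfolding g using prob_space_std_complex_gaussian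
    by (intro density_PiM) (auto simp: g[symmetric] prob_space_imp_sigma_finite intro: sigma_finite_lborel)
  also have "\<dots> = density (PiM UNIV (\<lambda>_. lborel)) (\<lambda>x. H (\<chi> p a. x (p, a)))"
    by (simp add: H_def case_prod_beta)
  finally have "distr (PiM (UNIV :: ('m \<times> 'd) set) (\<lambda>_. std_complex_gaussian)) borel (\<lambda>x. \<chi> p a. x (p, a))
      = density (distr (PiM (UNIV :: ('m \<times> 'd) set) (\<lambda>_. lborel)) borel (\<lambda>x. \<chi> p a. x (p, a))) H"
    by (subst density_distr) auto
  then show ?thesis
    by (simp add: lborel_matrix_eq_PiM gaussian_matrix_law_def H[abs_def])
qed

lemma prob_space_gaussian_matrix_law: "prob_space gaussian_matrix_law"
  unfolding gaussian_matrix_law_eq_PiM[symmetric]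
  by (intro prob_space.prob_space_distr prob_space_PiM prob_space_std_complex_gaussian) measurable

section \<open>Haar-random isometries\<close>

lemma is_haar_isometry_law_polar_factor:
  assumes card: "CARD('d) \<le> CARD('m)"
  shows "is_haar_isometry_law (distr gaussian_matrix_law borel (polar_factor :: complex^'d^'m \<Rightarrow> _))"
proof -
  interpret prob_space "gaussian_matrix_law :: (complex^'d^'m) measure"
    by (rule prob_space_gaussian_matrix_law)
  have [measurable]: "{V :: complex^'d^'m. isometry_matrix V} \<in> sets borel"
    by (rule borel_closed[OF closed_isometries])
  have "AE G :: complex^'d^'m in gaussian_matrix_law. isometry_matrix (polar_factor G)"
    using AE_gaussian_invertible_gram[OF card] isometry_polar_factor[OF card] by (auto elim!: eventually_mono)
  then have iso: "AE V in distr gaussian_matrix_law borel (polar_factor :: complex^'d^'m \<Rightarrow> _). isometry_matrix V"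
    by (subst AE_distr_iff) auto
  have inv: "distr (distr gaussian_matrix_law borel (polar_factor :: complex^'d^'m \<Rightarrow> _)) borel (\<lambda>V. U2 ** V ** U1)
      = distr gaussian_matrix_law borel polar_factor"
    if U1: "unitary_matrix U1" and U2: "unitary_matrix U2" for U1 U2
  proof -
    have eq: "U2 ** polar_factor G ** U1 = polar_factor (U2 ** G ** U1)"
      if "invertible (ctranspose G ** G)" for G :: "complex^'d^'m"
    proof -
      have "ctranspose (U2 ** G) ** (U2 ** G) = ctranspose G ** (ctranspose U2 ** U2) ** G"
        by (simp only: ctranspose_mult matrix_mul_assoc)
      then have "invertible (ctranspose (U2 ** G) ** (U2 ** G))"
        using that U2 by (simp only: unitary_matrix_def matrix_mul_rid)
      then show ?thesis
        by (simp add: polar_factor_mult_unitary_right[OF card _ U1] polar_factor_mult_unitary_left[OF U2])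
    qed
    have "distr (distr gaussian_matrix_law borel (polar_factor :: complex^'d^'m \<Rightarrow> _)) borel (\<lambda>V. U2 ** V ** U1)
        = distr gaussian_matrix_law borel (\<lambda>G. U2 ** polar_factor G ** U1)"
      by (subst distr_distr) (auto simp: o_def)
    also have "\<dots> = distr gaussian_matrix_law borel (\<lambda>G. polar_factor (U2 ** G ** U1))"
      using AE_gaussian_invertible_gram[OF card]
      by (intro distr_cong_AE) (auto elim!: eventually_mono simp: eq)
    also have "\<dots> = distr (distr gaussian_matrix_law borel (\<lambda>G. U2 ** G ** U1)) borel polar_factor"
      by (subst distr_distr) (auto simp: o_def)
    finally show ?thesis
      by (simp only: gaussian_matrix_law_unitary[OF U1 U2])
  qed
  show ?thesis
    using iso inv by (simp add: is_haar_isometry_law_def prob_space_distr)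
qed

lemma unitary_matrix_mat_1: "unitary_matrix (mat 1)"
  by (simp add: unitary_matrix_def)

lemma is_haar_isometry_law_left:
  assumes "is_haar_isometry_law \<mu>" "unitary_matrix U"
  shows "distr \<mu> borel (\<lambda>V. U ** V) = \<mu>"
proof -
  have "distr \<mu> borel (\<lambda>V. U ** V ** mat 1) = \<mu>"
    using assms unitary_matrix_mat_1 unfolding is_haar_isometry_law_def by blast
  then show ?thesis by simp
qed

lemma is_haar_isometry_law_right:
  assumes "is_haar_isometry_law \<mu>" "unitary_matrix U"
  shows "distr \<mu> borel (\<lambda>V. V ** U) = \<mu>"
proof -
  have "distr \<mu> borel (\<lambda>V. mat 1 ** V ** U) = \<mu>"
    using assms unitary_matrix_mat_1 unfolding is_haar_isometry_law_def by blast
  then show ?thesis by simp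
qed

text \<open>For \<open>V\<close> with an invariant law and an independent Haar unitary \<open>U\<close>, the law of \<open>U ** V\<close> is that of \<open>V\<close> by
  invariance, and that of \<open>U ** J\<close> because \<open>V = W ** J\<close> with \<open>W\<close> unitary.\<close>
lemma is_haar_isometry_law_eq:
  fixes \<mu> :: "(complex^'d^'m) measure" and h :: "(complex^'m^'m) measure"
  assumes \<mu>: "is_haar_isometry_law \<mu>" and h: "is_haar_isometry_law h"
    and J: "isometry_matrix J"
  shows "\<mu> = distr h borel (\<lambda>U. U ** J)"
proof (rule measure_eqI)
  have sets[measurable_cong]: "sets \<mu> = sets borel" "sets h = sets borel"
    using \<mu> h by (auto simp: is_haar_isometry_law_def)
  have space: "space \<mu> = UNIV" "space h = UNIV"
    using sets[THEN sets_eq_imp_space_eq] by auto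
  show "sets \<mu> = sets (distr h borel (\<lambda>U. U ** J))" by (simp add: sets)
  interpret \<mu>: prob_space \<mu> using \<mu> by (simp add: is_haar_isometry_law_def)
  interpret h: prob_space h using h by (simp add: is_haar_isometry_law_def)
  interpret P: pair_sigma_finite h \<mu> ..
  fix A assume "A \<in> sets \<mu>"
  then have A[measurable]: "A \<in> sets borel" by (simp add: sets)
  have left: "(\<integral>\<^sup>+ V. indicator A (U ** V) \<partial>\<mu>) = emeasure \<mu> A" if "isometry_matrix U" for U
  proof -
    have "emeasure \<mu> A = emeasure (distr \<mu> borel (\<lambda>V. U ** V)) A"
      using is_haar_isometry_law_left[OF \<mu>] that by (simp add: unitary_matrix_iff_isometry)
    also have "\<dots> = (\<integral>\<^sup>+ V. indicator A V \<partial>distr \<mu> borel (\<lambda>V. U ** V))"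
      by simp
    also have "\<dots> = (\<integral>\<^sup>+ V. indicator A (U ** V) \<partial>\<mu>)"
      by (rule nn_integral_distr) measurable
    finally show ?thesis ..
  qed
  have right: "(\<integral>\<^sup>+ U. indicator A (U ** V) \<partial>h) = emeasure (distr h borel (\<lambda>U. U ** J)) A"
    if V: "isometry_matrix V" for V
  proof -
    obtain W where W: "unitary_matrix W" "W ** J = V"
      by (rule unitary_transitive_on_isometries[OF J V])
    have "emeasure (distr h borel (\<lambda>U. U ** J)) A
        = emeasure (distr (distr h borel (\<lambda>U. U ** W)) borel (\<lambda>U. U ** J)) A"
      by (simp only: is_haar_isometry_law_right[OF h W(1)])
    also have "distr (distr h borel (\<lambda>U. U ** W)) borel (\<lambda>U. U ** J) = distr h borel (\<lambda>U. U ** V)"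
      by (subst distr_distr) (auto simp: o_def matrix_mul_assoc[symmetric] W(2))
    also have "emeasure \<dots> A = (\<integral>\<^sup>+ U. indicator A U \<partial>distr h borel (\<lambda>U. U ** V))"
      by simp
    also have "\<dots> = (\<integral>\<^sup>+ U. indicator A (U ** V) \<partial>h)"
      by (rule nn_integral_distr) measurable
    finally show ?thesis ..
  qed
  have "emeasure \<mu> A = (\<integral>\<^sup>+ U. emeasure \<mu> A \<partial>h)"
    by (simp add: h.emeasure_space_1)
  also have "\<dots> = (\<integral>\<^sup>+ U. (\<integral>\<^sup>+ V. indicator A (U ** V) \<partial>\<mu>) \<partial>h)"
    \<comment> \<open>\<open>h\<close>-almost every \<open>U\<close> is a square isometry, hence
      unitary, and invariance of \<open>\<mu>\<close> applies to it.\<close>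
    using h by (intro nn_integral_cong_AE) (auto simp: is_haar_isometry_law_def left elim!: eventually_mono)
  also have "\<dots> = (\<integral>\<^sup>+ V. (\<integral>\<^sup>+ U. indicator A (U ** V) \<partial>h) \<partial>\<mu>)"
    by (rule P.Fubini'[symmetric]) measurable
  also have "\<dots> = (\<integral>\<^sup>+ V. emeasure (distr h borel (\<lambda>U. U ** J)) A \<partial>\<mu>)"
    using \<mu> by (intro nn_integral_cong_AE) (auto simp: is_haar_isometry_law_def right elim!: eventually_mono)
  also have "\<dots> = emeasure (distr h borel (\<lambda>U. U ** J)) A"
    by (simp add: \<mu>.emeasure_space_1)
  finally show "emeasure \<mu> A = emeasure (distr h borel (\<lambda>U. U ** J)) A" .
qed

text \<open>With \<open>h\<close> the polar factor law for square matrices, every invariant law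
  equals the image of \<open>h\<close> under \<open>U \<mapsto> U ** J\<close>; this holds for the
  polar factor law and for any competitor, which therefore agree.\<close>

lemma haar_isometry_law_eq_polar_factor:
  assumes card: "CARD('d) \<le> CARD('m)"
  shows "(haar_isometry_law :: (complex^'d^'m) measure) = distr gaussian_matrix_law borel polar_factor"
  unfolding haar_isometry_law_def
proof (rule the_equality)
  show "is_haar_isometry_law (distr gaussian_matrix_law borel (polar_factor :: complex^'d^'m \<Rightarrow> _))"
    by (rule is_haar_isometry_law_polar_factor[OF card])
  fix \<mu> :: "(complex^'d^'m) measure" assume "is_haar_isometry_law \<mu>"
  then show "\<mu> = distr gaussian_matrix_law borel polar_factor"
    using is_haar_isometry_law_eq is_haar_isometry_law_polar_factor[OF card]
      is_haar_isometry_law_polar_factor[where 'd = 'm and 'm = 'm] isometry_coordinate_embedding[OF card]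
    by (metis order_refl)
qed

section \<open>Wishart matrices as blocks of a Gaussian matrix\<close>

lemma PiM_distr:
  assumes I: "finite I" and M: "\<And>i. prob_space (M i)" and f[measurable]: "\<And>i. f i \<in> measurable (M i) (N i)"
  shows "PiM I (\<lambda>i. distr (M i) (N i) (f i)) = distr (PiM I M) (PiM I N) (\<lambda>x. \<lambda>i\<in>I. f i (x i))"
proof -
  interpret M: product_sigma_finite M
    using M by (simp add: product_sigma_finite_def prob_space_imp_sigma_finite)
  interpret D: product_sigma_finite "\<lambda>i. distr (M i) (N i) (f i)"
    using M by (simp add: product_sigma_finite_def prob_space_imp_sigma_finite prob_space.prob_space_distr)
  have sets: "sets (PiM I (\<lambda>i. distr (M i) (N i) (f i))) = sets (PiM I N)"
    by (intro sets_PiM_cong) auto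
  show ?thesis
  proof (rule D.PiM_eqI[symmetric, OF I])
    show "sets (distr (PiM I M) (PiM I N) (\<lambda>x. \<lambda>i\<in>I. f i (x i))) = sets (PiM I (\<lambda>i. distr (M i) (N i) (f i)))"
      by (simp add: sets)
    fix A assume "\<And>i. i \<in> I \<Longrightarrow> A i \<in> sets (distr (M i) (N i) (f i))"
    then have A: "i \<in> I \<Longrightarrow> A i \<in> sets (N i)" for i by simp
    have "(\<lambda>x. \<lambda>i\<in>I. f i (x i)) -` Pi\<^sub>E I A \<inter> space (PiM I M) = (\<Pi>\<^sub>E i\<in>I. f i -` A i \<inter> space (M i))"
      by (auto simp: space_PiM PiE_iff)
    moreover have "Pi\<^sub>E I A \<in> sets (PiM I N)"
      using I A by (intro sets_PiM_I_finite) auto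
    moreover have "(\<lambda>x. \<lambda>i\<in>I. f i (x i)) \<in> measurable (PiM I M) (PiM I N)"
      by measurable
    ultimately have "emeasure (distr (PiM I M) (PiM I N) (\<lambda>x. \<lambda>i\<in>I. f i (x i))) (Pi\<^sub>E I A)
        = emeasure (PiM I M) (\<Pi>\<^sub>E i\<in>I. f i -` A i \<inter> space (M i))"
      by (simp add: emeasure_distr)
    also have "\<dots> = (\<Prod>i\<in>I. emeasure (M i) (f i -` A i \<inter> space (M i)))"
      using A by (intro M.emeasure_PiM I measurable_sets[OF f])
    also have "\<dots> = (\<Prod>i\<in>I. emeasure (distr (M i) (N i) (f i)) (A i))"
      using A by (intro prod.cong refl) (simp add: emeasure_distr)
    finally show "emeasure (distr (PiM I M) (PiM I N) (\<lambda>x. \<lambda>i\<in>I. f i (x i))) (Pi\<^sub>E I A)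
        = (\<Prod>i\<in>I. emeasure (distr (M i) (N i) (f i)) (A i))" .
  qed
qed

text \<open>Rows of a Wishart factor are numbered by naturals below \<open>s\<close>, rows of a
  block by the type \<open>'n\<close>; \<open>f\<close> translates between them while the family of
  arrays is merged into a single one.\<close>

lemma measurable_PiM_flatten:
  fixes f :: "'n \<Rightarrow> nat" and M :: "'c measure"
  assumes fs: "\<And>j. f j < s"
  shows "(\<lambda>x p. x (fst (fst p)) (f (snd (fst p)), snd p))
    \<in> measurable (PiM (UNIV :: 'k set) (\<lambda>_. PiM ({..<s} \<times> (UNIV :: 'd set)) (\<lambda>_. M)))
      (PiM (UNIV :: (('k \<times> 'n) \<times> 'd) set) (\<lambda>_. M))" (is "?f \<in> measurable ?P ?F")
proof (rule measurable_PiM_single')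
  show comp: "(\<lambda>x. x (fst (fst p)) (f (snd (fst p)), snd p)) \<in> measurable ?P M" for p :: "('k \<times> 'n) \<times> 'd"
  proof -
    have 1: "(\<lambda>x. x (fst (fst p))) \<in> measurable ?P (PiM ({..<s} \<times> (UNIV :: 'd set)) (\<lambda>_. M))"
      by (rule measurable_component_singleton) simp
    have 2: "(\<lambda>x. x (f (snd (fst p)), snd p)) \<in> measurable (PiM ({..<s} \<times> (UNIV :: 'd set)) (\<lambda>_. M)) M"
      by (rule measurable_component_singleton) (simp add: fs)
    show ?thesis by (rule measurable_compose[OF 1 2])
  qed
  show "?f \<in> space ?P \<rightarrow> (\<Pi>\<^sub>E i\<in>UNIV. space M)"
    using measurable_space[OF comp] by (auto simp: PiE_iff)
qed

text \<open>The preimage of a rectangle is a product over \<open>i\<close> of rectangles, with sides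
  relabelled through \<open>inv f\<close>; reindexing along \<open>f\<close> matches the two
  products of masses.\<close>

lemma PiM_PiM_eq_PiM:
  fixes f :: "'n::finite \<Rightarrow> nat" and M :: "'c measure"
  assumes M: "prob_space M" and f: "bij_betw f UNIV {..<s}"
  shows "distr (PiM (UNIV :: 'k::finite set) (\<lambda>_. PiM ({..<s} \<times> (UNIV :: 'd::finite set)) (\<lambda>_. M)))
      (PiM (UNIV :: (('k \<times> 'n) \<times> 'd) set) (\<lambda>_. M)) (\<lambda>x p. x (fst (fst p)) (f (snd (fst p)), snd p))
    = PiM UNIV (\<lambda>_. M)" (is "distr ?P ?F ?f = ?F")
proof -
  interpret F: product_sigma_finite "\<lambda>_ :: ('k \<times> 'n) \<times> 'd. M"
    using M by (simp add: product_sigma_finite_def prob_space_imp_sigma_finite)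
  interpret R: product_sigma_finite "\<lambda>_ :: nat \<times> 'd. M"
    using M by (simp add: product_sigma_finite_def prob_space_imp_sigma_finite)
  interpret P: product_sigma_finite "\<lambda>_ :: 'k. PiM ({..<s} \<times> (UNIV :: 'd set)) (\<lambda>_. M)"
    using M by (simp add: product_sigma_finite_def prob_space_imp_sigma_finite prob_space_PiM)
  have fs: "f j < s" for j using f by (auto simp: bij_betw_def)
  have inv: "inv f (f j) = j" for j using f by (simp add: bij_betw_def inj_def)
  have fr: "\<exists>j. r = f j" if "r < s" for r using f that by (auto simp: bij_betw_def image_iff set_eq_iff)
  have meas: "?f \<in> measurable ?P ?F"
    by (rule measurable_PiM_flatten) (rule fs)
  show ?thesis
  proof (rule F.PiM_eqI)
    show "finite (UNIV :: (('k \<times> 'n) \<times> 'd) set)" "sets (distr ?P ?F ?f) = sets ?F" by simp_all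
    fix A :: "('k \<times> 'n) \<times> 'd \<Rightarrow> 'c set" assume A: "\<And>p. p \<in> UNIV \<Longrightarrow> A p \<in> sets M"
    define B where "B i = (\<Pi>\<^sub>E q\<in>{..<s} \<times> UNIV. A ((i, inv f (fst q)), snd q))" for i
    have B: "B i \<in> sets (PiM ({..<s} \<times> UNIV) (\<lambda>_. M))" for i
      unfolding B_def using A by (intro sets_PiM_I_finite) auto
    have vimage: "?f -` Pi\<^sub>E UNIV A \<inter> space ?P = Pi\<^sub>E UNIV B"
    proof (intro set_eqI iffI)
      fix x assume x: "x \<in> ?f -` Pi\<^sub>E UNIV A \<inter> space ?P"
      have "x i \<in> B i" for i
        unfolding B_def
      proof (rule PiE_I)
        fix q :: "nat \<times> 'd" assume "q \<in> {..<s} \<times> UNIV"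
        then obtain j a where q: "q = (f j, a)" using fr by (cases q) auto
        have "?f x ((i, j), a) \<in> A ((i, j), a)" using x by (auto simp: PiE_iff)
        then show "x i q \<in> A ((i, inv f (fst q)), snd q)" by (simp add: q inv)
      next
        \<comment> \<open>Arrays are defined on all pairs of a natural and a column, and points of
          the product space are \<open>undefined\<close> off the index set; this has to be checked
          as well.\<close>
        fix q :: "nat \<times> 'd" assume q: "q \<notin> {..<s} \<times> UNIV"
        have "x i \<in> extensional ({..<s} \<times> UNIV)"
          using x by (auto simp: space_PiM PiE_iff)
        then show "x i q = undefined" using q by (rule extensional_arb)
      qed
      then show "x \<in> Pi\<^sub>E UNIV B" by (simp add: PiE_iff)
    next
      fix x assume "x \<in> Pi\<^sub>E UNIV B"
      then have x: "x i \<in> B i" for i by (simp add: PiE_iff)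
      have "?f x p \<in> A p" for p
      proof -
        obtain i j a where p: "p = ((i, j), a)" by (metis surj_pair)
        have "x i (f j, a) \<in> A ((i, inv f (fst (f j, a))), snd (f j, a))"
          using x[of i] unfolding B_def by (rule PiE_mem) (simp add: fs)
        then show ?thesis by (simp add: p inv)
      qed
      moreover have "x \<in> space ?P"
      proof -
        have "x i \<in> space (PiM ({..<s} \<times> (UNIV :: 'd set)) (\<lambda>_. M))" for i
          using x[of i] sets.sets_into_space[OF B[of i]] by blast
        then show ?thesis by (simp add: space_PiM PiE_iff)
      qed
      ultimately show "x \<in> ?f -` Pi\<^sub>E UNIV A \<inter> space ?P" by (simp add: PiE_iff)
    qed
    have "emeasure (distr ?P ?F ?f) (Pi\<^sub>E UNIV A) = emeasure ?P (Pi\<^sub>E UNIV B)"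
      unfolding vimage[symmetric] using A by (intro emeasure_distr meas sets_PiM_I_finite) auto
    also have "\<dots> = (\<Prod>i\<in>UNIV. emeasure (PiM ({..<s} \<times> UNIV) (\<lambda>_. M)) (B i))"
      using B by (intro P.emeasure_PiM) auto
    also have "\<dots> = (\<Prod>i\<in>UNIV. \<Prod>q\<in>{..<s} \<times> UNIV. emeasure M (A ((i, inv f (fst q)), snd q)))"
      unfolding B_def using A by (intro prod.cong refl R.emeasure_PiM) auto
    also have "\<dots> = (\<Prod>i\<in>UNIV. \<Prod>r\<in>{..<s}. \<Prod>a\<in>UNIV. emeasure M (A ((i, inv f r), a)))"
      by (simp add: prod.cartesian_product case_prod_beta)
    also have "\<dots> = (\<Prod>i\<in>UNIV. \<Prod>j\<in>UNIV. \<Prod>a\<in>UNIV. emeasure M (A ((i, j), a)))"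
      by (subst prod.reindex_bij_betw[OF f, symmetric]) (simp add: inv)
    also have "\<dots> = (\<Prod>q\<in>UNIV. \<Prod>a\<in>UNIV. emeasure M (A (q, a)))"
      by (subst prod.cartesian_product) (simp add: case_prod_beta)
    also have "\<dots> = (\<Prod>p\<in>UNIV. emeasure M (A p))"
      by (simp add: prod.cartesian_product case_prod_beta)
    finally show "emeasure (distr ?P ?F ?f) (Pi\<^sub>E UNIV A) = (\<Prod>p\<in>UNIV. emeasure M (A p))" .
  qed
qed

section \<open>Block projections\<close>

lemma tensor_matrix_mult:
  "tensor_matrix A B ** tensor_matrix C D = tensor_matrix (A ** C) (B ** D)"
proof -
  have "(\<Sum>r\<in>UNIV. f (fst r) * g (snd r)) = (\<Sum>a\<in>UNIV. f a) * (\<Sum>b\<in>UNIV. g b)"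
    for f :: "'a \<Rightarrow> complex" and g :: "'b \<Rightarrow> complex"
    by (simp add: sum_product sum.cartesian_product case_prod_beta)
  from this[of "\<lambda>a. A $ _ $ a * C $ a $ _" "\<lambda>b. B $ _ $ b * D $ b $ _"] show ?thesis
    by (simp add: vec_eq_iff matrix_mult_nth tensor_matrix_def mult_ac)
qed

lemma ctranspose_tensor_matrix: "ctranspose (tensor_matrix A B) = tensor_matrix (ctranspose A) (ctranspose B)"
  by (simp add: vec_eq_iff tensor_matrix_def)

lemma tensor_matrix_mat_1: "tensor_matrix (mat 1) (mat 1) = mat 1"
  by (auto simp: vec_eq_iff tensor_matrix_def mat_def prod_eq_iff)

text \<open>The projection onto the \<open>i\<close>-th block of coordinates, that is, the Haar
  effect operator for the standard basis. Its compression by \<open>G\<close> is the Gram matrix of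
  the rows \<open>(i, j)\<close> of \<open>G\<close>.\<close>

definition block_projection :: "'k::finite \<Rightarrow> complex^('k \<times> 'n::finite)^('k \<times> 'n)" where
  "block_projection i = tensor_matrix (ketbra (axis i 1)) (mat 1)"

lemma block_gram_nth:
  fixes G :: "complex^'d^('k::finite \<times> 'n::finite)"
  shows "(ctranspose G ** block_projection i ** G) $ a $ b = (\<Sum>j\<in>UNIV. cnj (G $ (i, j) $ a) * G $ (i, j) $ b)"
proof -
  have P: "(block_projection i ** G) $ (i', j) $ b = (if i' = i then G $ (i, j) $ b else 0)" for i' j
  proof -
    have "(block_projection i ** G) $ (i', j) $ b
        = (\<Sum>q\<in>UNIV. if q = (i, j) then (if i' = i then G $ (i, j) $ b else 0) else 0)"
      unfolding matrix_mult_nth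
      by (intro sum.cong refl) (auto simp: block_projection_def tensor_matrix_def ketbra_def axis_def mat_def prod_eq_iff)
    then show ?thesis by simp
  qed
  have "(ctranspose G ** block_projection i ** G) $ a $ b
      = (\<Sum>p\<in>UNIV. cnj (G $ p $ a) * (block_projection i ** G) $ p $ b)"
    unfolding matrix_mul_assoc[symmetric] by (simp add: matrix_mult_nth[of "ctranspose G"])
  also have "\<dots> = (\<Sum>i'\<in>UNIV. \<Sum>j\<in>UNIV. cnj (G $ (i', j) $ a) * (block_projection i ** G) $ (i', j) $ b)"
    by (simp add: sum.cartesian_product case_prod_beta)
  also have "\<dots> = (\<Sum>i'\<in>UNIV. if i' = i then (\<Sum>j\<in>UNIV. cnj (G $ (i, j) $ a) * G $ (i, j) $ b) else 0)"
    by (intro sum.cong refl) (auto simp: P)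
  finally show ?thesis by simp
qed

lemma sum_block_gram:
  fixes G :: "complex^'d^('k::finite \<times> 'n::finite)"
  shows "(\<Sum>i\<in>UNIV. ctranspose G ** block_projection i ** G) = ctranspose G ** G"
  by (simp add: vec_eq_iff block_gram_nth matrix_mult_nth[of "ctranspose G" G] sum.cartesian_product case_prod_beta)

lemma orthonormal_basis_block_projection:
  fixes e :: "'k::finite \<Rightarrow> complex^'k"
  assumes "orthonormal_basis e"
  obtains Q :: "complex^('k \<times> 'n::finite)^('k \<times> 'n)" where "unitary_matrix Q"
    "\<And>i. ctranspose Q ** block_projection i ** Q = tensor_matrix (ketbra (e i)) (mat 1)"
proof -
  \<comment> \<open>Conjugated so that column \<open>i\<close> of \<open>ctranspose E\<close> is
    \<open>e i\<close>. Orthonormality says \<open>E E* = 1\<close>, and since \<open>E\<close> is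
    square it is unitary; the required \<open>Q\<close> is its tensor product with the
    identity.\<close>
  define E :: "complex^'k^'k" where "E = (\<chi> i a. cnj (e i $ a))"
  have "E ** ctranspose E = mat 1"
    using assms by (simp add: vec_eq_iff matrix_mult_nth E_def orthonormal_basis_def cinner_def mat_def)
  then have E: "ctranspose E ** E = mat 1"
    by (simp add: matrix_left_right_inverse)
  have ket: "ctranspose E ** ketbra (axis i 1) ** E = ketbra (e i)" for i
  proof -
    have K: "(ketbra (axis i 1) ** E) $ i' $ b = (if i' = i then E $ i $ b else 0)" for i' b
    proof -
      have "(ketbra (axis i 1) ** E) $ i' $ b = (\<Sum>q\<in>UNIV. if q = i then (if i' = i then E $ i $ b else 0) else 0)"
        unfolding matrix_mult_nth by (intro sum.cong refl) (auto simp: ketbra_def axis_def)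
      then show ?thesis by simp
    qed
    have "(ctranspose E ** (ketbra (axis i 1) ** E)) $ a $ b = ketbra (e i) $ a $ b" for a b
    proof -
      have "(ctranspose E ** (ketbra (axis i 1) ** E)) $ a $ b
          = (\<Sum>q\<in>UNIV. if q = i then cnj (E $ i $ a) * E $ i $ b else 0)"
        unfolding matrix_mult_nth[of "ctranspose E"] by (intro sum.cong refl) (simp add: K)
      then show ?thesis by (simp add: ketbra_def E_def)
    qed
    then show ?thesis by (simp add: vec_eq_iff matrix_mul_assoc)
  qed
  define Q :: "complex^('k \<times> 'n)^('k \<times> 'n)" where "Q = tensor_matrix E (mat 1)"
  show ?thesis
  proof
    show "unitary_matrix Q"
      by (intro unitary_matrixI)
        (simp add: Q_def ctranspose_tensor_matrix tensor_matrix_mult E tensor_matrix_mat_1)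
    show "ctranspose Q ** block_projection i ** Q = tensor_matrix (ketbra (e i)) (mat 1)" for i
      by (simp add: Q_def ctranspose_tensor_matrix block_projection_def tensor_matrix_mult ket)
  qed
qed

text \<open>Both sides are images of one family of independent Gaussian arrays: merging the arrays
  into one matrix yields the Gaussian law, and pointwise each Wishart matrix is a block Gram matrix
  of the merged one.\<close>

lemma wishart_povm_law_eq_gaussian:
  "(wishart_povm_law (\<lambda>_::'k::finite. CARD('n::finite)) :: (complex^'d^'d^'k) measure)
     = distr gaussian_matrix_law borel
         (\<lambda>G :: complex^'d^('k \<times> 'n). normalise_tuple (\<lambda>i. ctranspose G ** block_projection i ** G))"
proof -
  define P :: "(nat \<times> 'd \<Rightarrow> complex) measure"
    where "P = PiM ({..<CARD('n)} \<times> UNIV) (\<lambda>_. std_complex_gaussian)"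
  define w :: "(nat \<times> 'd \<Rightarrow> complex) \<Rightarrow> complex^'d^'d"
    where "w G = (\<chi> a b. \<Sum>r<CARD('n). cnj (G (r, a)) * G (r, b))" for G
  have P: "prob_space P"
    unfolding P_def by (intro prob_space_PiM prob_space_std_complex_gaussian)
  have w[measurable]: "w \<in> measurable P borel"
  proof -
    have [measurable]: "(\<lambda>x. x (r, a)) \<in> borel_measurable P" if "r < CARD('n)" for r a
      unfolding P_def using that
      by (subst measurable_cong_sets[OF refl sets_std_complex_gaussian[symmetric]])
        (auto intro!: measurable_component_singleton)
    have [measurable]: "cnj \<in> borel_measurable borel"
      by (intro borel_measurable_continuous_onI continuous_intros)
    show ?thesis
      unfolding w_def[abs_def]
      by (intro borel_measurable_vec_lambda borel_measurable_sum borel_measurable_times) auto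
  qed
  obtain f :: "'n \<Rightarrow> nat" where f: "bij_betw f UNIV {..<CARD('n)}"
    using ex_bij_betw_finite_nat[of "UNIV :: 'n set"] by (auto simp: atLeast0LessThan)
  define flat :: "('k \<Rightarrow> nat \<times> 'd \<Rightarrow> complex) \<Rightarrow> ('k \<times> 'n) \<times> 'd \<Rightarrow> complex"
    where "flat x = (\<lambda>p. x (fst (fst p)) (f (snd (fst p)), snd p))" for x
  \<comment> \<open>Inside this proof \<open>mat\<close> is the map assembling an array into a
    matrix and hides the constant for scalar matrices.\<close>
  define mat :: "(('k \<times> 'n) \<times> 'd \<Rightarrow> complex) \<Rightarrow> complex^'d^('k \<times> 'n)"
    where "mat y = (\<chi> p a. y (p, a))" for y
  define \<Psi> :: "complex^'d^('k \<times> 'n) \<Rightarrow> complex^'d^'d^'k"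
    where "\<Psi> G = normalise_tuple (\<lambda>i. ctranspose G ** block_projection i ** G)" for G
  define F where "F = PiM (UNIV :: (('k \<times> 'n) \<times> 'd) set) (\<lambda>_. std_complex_gaussian)"
  have flat: "distr (PiM UNIV (\<lambda>_::'k. P)) F flat = F"
    unfolding P_def F_def flat_def[abs_def]
    by (rule PiM_PiM_eq_PiM[OF prob_space_std_complex_gaussian f])
  have flat_m[measurable]: "flat \<in> measurable (PiM UNIV (\<lambda>_::'k. P)) F"
    unfolding P_def F_def flat_def[abs_def] using f
    by (intro measurable_PiM_flatten) (auto simp: bij_betw_def)
  have mat_m[measurable]: "mat \<in> borel_measurable F"
    unfolding F_def mat_def[abs_def] by measurable
  have mat: "distr F borel mat = gaussian_matrix_law"
    unfolding F_def mat_def[abs_def] by (rule gaussian_matrix_law_eq_PiM)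
  have \<Psi>_m[measurable]: "\<Psi> \<in> borel_measurable borel"
    unfolding \<Psi>_def[abs_def]
    by (intro measurable_compose[OF _ borel_measurable_normalise_tuple] measurable_PiM_single') auto
  have gram: "w (x i) = ctranspose (mat (flat x)) ** block_projection i ** mat (flat x)" for x i
  proof -
    have "(\<Sum>r<CARD('n). cnj (x i (r, a)) * x i (r, b)) = (\<Sum>j\<in>UNIV. cnj (x i (f j, a)) * x i (f j, b))" for a b
      by (subst sum.reindex_bij_betw[OF f, symmetric]) simp
    then show ?thesis
      by (simp add: vec_eq_iff block_gram_nth w_def mat_def flat_def)
  qed
  have "wishart_povm_law (\<lambda>_::'k. CARD('n)) = distr (PiM UNIV (\<lambda>_::'k. distr P borel w)) borel normalise_tuple"
    by (simp add: wishart_povm_law_def wishart_law_def P_def w_def[abs_def])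
  also have "PiM UNIV (\<lambda>_::'k. distr P borel w) = distr (PiM UNIV (\<lambda>_. P)) (PiM UNIV (\<lambda>_. borel)) (\<lambda>x i. w (x i))"
    using PiM_distr[of UNIV "\<lambda>_::'k. P" "\<lambda>_. w" "\<lambda>_. borel"] P w by (simp add: restrict_def)
  also have "distr \<dots> borel normalise_tuple = distr (PiM UNIV (\<lambda>_. P)) borel (\<lambda>x. \<Psi> (mat (flat x)))"
  proof -
    have "(\<lambda>x i. w (x i)) \<in> measurable (PiM UNIV (\<lambda>_::'k. P)) (PiM UNIV (\<lambda>_. borel))"
      by (intro measurable_PiM_single') auto
    then show ?thesis
      by (subst distr_distr[OF borel_measurable_normalise_tuple]) (simp_all add: o_def \<Psi>_def gram)
  qed
  also have "\<dots> = distr (distr (distr (PiM UNIV (\<lambda>_. P)) F flat) borel mat) borel \<Psi>"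
    by (simp add: distr_distr o_def)
  finally show ?thesis
    by (simp add: flat mat \<Psi>_def[abs_def])
qed

theorem theorem5p9:
  fixes e :: "'k::finite \<Rightarrow> complex^'k"
  assumes "orthonormal_basis e"
    and "CARD('d::finite) \<le> CARD('k) * CARD('n::finite)"
  shows "(wishart_povm_law (\<lambda>_::'k. CARD('n)) :: (complex^'d^'d^'k) measure)
       = haar_povm_law e TYPE('n)"
proof -
  have card: "CARD('d) \<le> CARD('k \<times> 'n)" using assms(2) by simp
  define blocks :: "complex^'d^('k \<times> 'n) \<Rightarrow> complex^'d^'d^'k"
    where "blocks V = (\<chi> i. ctranspose V ** block_projection i ** V)" for V
  have [measurable]: "blocks \<in> borel_measurable borel"
    unfolding blocks_def[abs_def] by measurable
  have [measurable]: "(\<lambda>G :: complex^'d^('k \<times> 'n). normalise_tuple (\<lambda>i. ctranspose G ** block_projection i ** G))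
      \<in> borel_measurable borel"
    by (intro measurable_compose[OF _ borel_measurable_normalise_tuple] measurable_PiM_single') auto
  \<comment> \<open>The block Gram matrices add up to \<open>G* G\<close>, so the normaliser
    \<open>T\<close> is the one in the polar factor; being self-adjoint, it turns
    \<open>T G* P G T\<close> into \<open>(G T)* P (G T)\<close>.\<close>
  have blocks: "normalise_tuple (\<lambda>i. ctranspose G ** block_projection i ** G) = blocks (polar_factor G)"
    if "invertible (ctranspose G ** G)" for G :: "complex^'d^('k \<times> 'n)"
    by (simp add: normalise_tuple_def Let_def sum_block_gram blocks_def polar_factor_def ctranspose_mult
        inv_sqrt_gram_adjoint[OF card that] matrix_mul_assoc)
  define \<nu> :: "(complex^'d^('k \<times> 'n)) measure" where "\<nu> = distr gaussian_matrix_law borel polar_factor"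
  have haar: "is_haar_isometry_law \<nu>" "haar_isometry_law = \<nu>"
    unfolding \<nu>_def using is_haar_isometry_law_polar_factor[OF card] haar_isometry_law_eq_polar_factor[OF card] by auto
  have [measurable_cong]: "sets \<nu> = sets borel" by (simp add: \<nu>_def)
  obtain Q :: "complex^('k \<times> 'n)^('k \<times> 'n)" where Q: "unitary_matrix Q"
    and e: "\<And>i. ctranspose Q ** block_projection i ** Q = tensor_matrix (ketbra (e i)) (mat 1)"
    using orthonormal_basis_block_projection[OF assms(1)] by blast
  have rotate: "distr \<nu> borel (\<lambda>V. Q ** V) = \<nu>"
    by (rule is_haar_isometry_law_left[OF haar(1) Q])
  have "wishart_povm_law (\<lambda>_::'k. CARD('n)) = distr gaussian_matrix_law borel (\<lambda>G. blocks (polar_factor G))"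
    unfolding wishart_povm_law_eq_gaussian using AE_gaussian_invertible_gram[OF card]
    by (intro distr_cong_AE) (auto elim!: eventually_mono simp: blocks)
  also have "\<dots> = distr \<nu> borel blocks"
    unfolding \<nu>_def by (subst distr_distr) (auto simp: o_def)
  also have "\<dots> = distr (distr \<nu> borel (\<lambda>V. Q ** V)) borel blocks"
    by (simp only: rotate)
  also have "\<dots> = distr \<nu> borel (\<lambda>V. blocks (Q ** V))"
    by (subst distr_distr) (auto simp: o_def)
  also have "(\<lambda>V. blocks (Q ** V))
      = (\<lambda>V. \<chi> i. ctranspose V ** tensor_matrix (ketbra (e i)) (mat 1 :: complex^'n^'n) ** V)"
    by (simp add: blocks_def e[symmetric] ctranspose_mult matrix_mul_assoc fun_eq_iff)
  also have "distr \<nu> borel \<dots> = haar_povm_law e TYPE('n)"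
    by (simp add: haar_povm_law_def haar(2))
  finally show ?thesis .
qed

end
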